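(* Fix an integer $s\ge 1$. For all but finitely many pairs of integers $(k,n)$ with $1<k<n-1$ (the number of exceptional pairs depending on $s$), the following holds: if $A$ is a set of $n$ positive integers with $d^s_k(A)\ge\binom{n-1}{k}$, then $A$ is a $(k,s)$-anti-pencil.
   Context: For a finite set $X$ of positive integers, write $\sum X=\sum_{x\in X}x$. Let $A$ be a set of $n$ positive integers with elements $a_1<a_2<\cdots<a_n$, and let $s\ge 1$ be an integer. A subset $B\subseteq A$ is an $s$-divisor of $A$ if $\sum B\mid s\sum A$. The number of $k$-element subsets of $A$ that are $s$-divisors of $A$ is denoted $d^s_k(A)$. The set $A$ is called a $(k,s)$-anti-pencil if the set of $k$-element subsets of $A$ that are $s$-divisors of $A$ is exactly $\binom{A\setminus\{a_n\}}{k}$, the set of all $k$-element subsets of $A\setminus\{a_n\}$, where $a_n$ is the largest element of $A$. *)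

theory Defs
  imports Complex_Main "HOL-Library.Ramsey"
begin

text \<open>
  Sets of positive integers are sets of natural numbers not containing 0.
  The library's \<^term>\<open>nsets A k\<close> is the set of all \<open>k\<close>-element subsets of \<open>A\<close>.
\<close>

definition s_divisor :: "nat \<Rightarrow> nat set \<Rightarrow> nat set \<Rightarrow> bool" where
  "s_divisor s A B \<longleftrightarrow> B \<subseteq> A \<and> \<Sum>B dvd s * \<Sum>A"

definition k_s_divisors :: "nat \<Rightarrow> nat \<Rightarrow> nat set \<Rightarrow> nat set set" where
  "k_s_divisors k s A = {B \<in> nsets A k. s_divisor s A B}"

definition num_s_divisors :: "nat \<Rightarrow> nat \<Rightarrow> nat set \<Rightarrow> nat" where
  "num_s_divisors s k A = card (k_s_divisors k s A)"

definition anti_pencil :: "nat \<Rightarrow> nat \<Rightarrow> nat set \<Rightarrow> bool" where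
  "anti_pencil k s A \<longleftrightarrow> k_s_divisors k s A = nsets (A - {Max A}) k"

end

theory Submission
  imports Defs
begin

text \<open>
  Put \<open>N = n - 1\<close> and \<open>M = s \<Sum>A\<close>, and let \<open>a\<close> be the largest element of \<open>A\<close>. If no divisor contains
  \<open>a\<close>, the count forces an anti-pencil. Otherwise \<open>a\<close> is at most \<open>s\<close> times the sum of the other
  elements, and for large \<open>n\<close> the number of divisors is below \<open>N choose k\<close>, for the following reasons.
  A fixed sum is attained by a proportion \<open>O(1/n)\<close> of the \<open>k\<close>-subsets, and only \<open>M / \<tau>\<close> divisors of \<open>M\<close>
  are at least \<open>\<tau>\<close>; hence divisors with sum of order \<open>M\<close> are rare.

  If \<open>k\<close> is at least a fixed proportion of \<open>n\<close>, a positive proportion of the \<open>k\<close>-subsets avoiding \<open>a\<close>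
  have sum of order \<open>M\<close> and so are mostly not divisors, while first and second moments show that divisors
  containing \<open>a\<close> are too rare to compensate. For \<open>n - k\<close> small this is applied to the complements, whose
  sums must be at least \<open>\<Sum>A / (s + 1)\<close>.

  If \<open>k\<close> is small compared to \<open>n\<close>, one looks for elements \<open>u > v\<close> whose distance is so small that
  \<open>u + t = M / d\<close> and \<open>v + t = M / d'\<close> force \<open>d' - d = M (u - v) / ((u + t) (v + t))\<close> to be bounded.
  This allows boundedly many \<open>t\<close>, so for almost all \<open>(k - 1)\<close>-sets \<open>Y\<close> at most one element of a cluster
  of four close elements extends \<open>Y\<close> to a divisor.
\<close>

subsection \<open>Sums of random subsets\<close>

lemma card_nsets:
  assumes "finite X"
  shows "card (nsets X j) = card X choose j"
proof -
  have "nsets X j = {B. B \<subseteq> X \<and> card B = j}"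
    using assms by (auto simp: nsets_def intro: finite_subset)
  then show ?thesis by (simp add: n_subsets assms)
qed

lemma nsets_containing:
  assumes "x \<in> X"
  shows "{B \<in> nsets X (Suc j). x \<in> B} = insert x ` nsets (X - {x}) j"
proof (intro equalityI subsetI)
  fix B assume "B \<in> {B \<in> nsets X (Suc j). x \<in> B}"
  then have "B - {x} \<in> nsets (X - {x}) j" "B = insert x (B - {x})"
    by (auto simp: nsets_def)
  then show "B \<in> insert x ` nsets (X - {x}) j" by blast
next
  fix B assume "B \<in> insert x ` nsets (X - {x}) j"
  then obtain Y where "Y \<in> nsets (X - {x}) j" "B = insert x Y" by auto
  then show "B \<in> {B \<in> nsets X (Suc j). x \<in> B}"
    using assms by (auto simp: nsets_def card_insert_if)
qed

lemma inj_on_insert_nsets: "inj_on (insert x) (nsets (X - {x}) j)"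
proof (rule inj_onI)
  fix Y Z assume "Y \<in> nsets (X - {x}) j" "Z \<in> nsets (X - {x}) j" "insert x Y = insert x Z"
  moreover from this have "x \<notin> Y" "x \<notin> Z" by (auto simp: nsets_def)
  ultimately show "Y = Z" by (simp add: insert_ident)
qed

lemma card_nsets_containing:
  assumes "finite X" "x \<in> X"
  shows "card {B \<in> nsets X (Suc j). x \<in> B} = (card X - 1) choose j"
  using assms by (simp add: nsets_containing card_image inj_on_insert_nsets card_nsets)

lemma card_nsets_containing_sum_le:
  fixes X :: "nat set"
  assumes "finite X" "x \<in> X"
  shows "card {B \<in> nsets X (Suc j). x \<in> B \<and> P (\<Sum>B)}
    \<le> card {Y \<in> nsets (X - {x}) j. P (x + \<Sum>Y)}"
proof (rule surj_card_le[where f = "insert x"])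
  show "finite {Y \<in> nsets (X - {x}) j. P (x + \<Sum>Y)}"
    using assms by (simp add: finite_imp_finite_nsets)
  show "{B \<in> nsets X (Suc j). x \<in> B \<and> P (\<Sum>B)} \<subseteq> insert x ` {Y \<in> nsets (X - {x}) j. P (x + \<Sum>Y)}"
  proof
    fix B assume B: "B \<in> {B \<in> nsets X (Suc j). x \<in> B \<and> P (\<Sum>B)}"
    then have "B \<in> insert x ` nsets (X - {x}) j"
      using nsets_containing[OF assms(2)] by blast
    then obtain Y where Y: "Y \<in> nsets (X - {x}) j" "B = insert x Y" by auto
    then have "\<Sum>B = x + \<Sum>Y" by (subst Y(2), subst sum.insert) (auto simp: nsets_def)
    then show "B \<in> insert x ` {Y \<in> nsets (X - {x}) j. P (x + \<Sum>Y)}" using B Y by auto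
  qed
qed

text \<open>Double counting of pairs \<open>(Y, y)\<close> with \<open>y \<in> Y\<close>: once the
  sum \<open>t\<close> is prescribed, \<open>Y - {y}\<close> determines \<open>y\<close> and hence
  the pair, so there are no more pairs than \<open>j\<close>-subsets.\<close>

lemma card_nsets_sum_eq_times_le:
  fixes X :: "nat set"
  assumes "finite X"
  shows "card {Y \<in> nsets X (Suc j). \<Sum>Y = t} * Suc j \<le> card X choose j"
proof -
  let ?F = "{Y \<in> nsets X (Suc j). \<Sum>Y = t}"
  have fF: "finite ?F" using assms by (simp add: finite_imp_finite_nsets)
  have *: "y + \<Sum>(Y - {y}) = t" if "Y \<in> ?F" "y \<in> Y" for Y y
  proof -
    have "finite Y" "\<Sum>Y = t" using that by (auto simp: nsets_def)
    then show ?thesis using sum.remove[of Y y "\<lambda>x. x"] that(2) by simp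
  qed
  have "card (Sigma ?F (\<lambda>Y. Y)) = (\<Sum>Y\<in>?F. card Y)"
    using fF by (intro card_SigmaI) (auto simp: nsets_def)
  also have "\<dots> = (\<Sum>Y\<in>?F. Suc j)"
    by (rule sum.cong) (auto simp: nsets_def)
  finally have c: "card (Sigma ?F (\<lambda>Y. Y)) = card ?F * Suc j" by simp
  have "card (Sigma ?F (\<lambda>Y. Y)) \<le> card (nsets X j)"
  proof (rule card_inj_on_le[where f = "\<lambda>(Y, y). Y - {y}"])
    show "inj_on (\<lambda>(Y, y). Y - {y}) (Sigma ?F (\<lambda>Y. Y))"
    proof (rule inj_onI)
      fix p p' assume pp: "p \<in> Sigma ?F (\<lambda>Y. Y)" "p' \<in> Sigma ?F (\<lambda>Y. Y)"
        and e: "(\<lambda>(Y, y). Y - {y}) p = (\<lambda>(Y, y). Y - {y}) p'"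
      obtain Y y Y' y' where p: "p = (Y, y)" "p' = (Y', y')" by (cases p, cases p')
      have Y: "Y \<in> ?F" "Y' \<in> ?F" "y \<in> Y" "y' \<in> Y'" and e': "Y - {y} = Y' - {y'}"
        using pp e unfolding p by blast+
      have "y + \<Sum>(Y - {y}) = y' + \<Sum>(Y - {y})"
        using *[OF Y(1,3)] *[OF Y(2,4)] e' by (simp only:)
      then have "y = y'" by simp
      then show "p = p'" using e' Y(3,4) unfolding p by blast
    qed
    show "(\<lambda>(Y, y). Y - {y}) ` Sigma ?F (\<lambda>Y. Y) \<subseteq> nsets X j"
      by (auto simp: nsets_def)
    show "finite (nsets X j)" using assms by (rule finite_imp_finite_nsets)
  qed
  then show ?thesis using c assms by (simp add: card_nsets)
qed

text \<open>The previous bound, rescaled by the ratio of consecutive binomial coefficients. It is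
  strong as long as \<open>j\<close> stays away from \<open>card X\<close>.\<close>

lemma card_nsets_sum_eq_le_codegree:
  fixes X :: "nat set"
  assumes "finite X" "0 < j" "j \<le> card X"
  shows "card {Y \<in> nsets X j. \<Sum>Y = t} * (card X - j + 1) \<le> card X choose j"
proof -
  obtain i where i: "j = Suc i" using assms(2) gr0_implies_Suc by blast
  let ?c = "card {Y \<in> nsets X j. \<Sum>Y = t}"
  have "?c * (card X - j + 1) * j \<le> (card X choose i) * (card X - i)"
  proof -
    have "card X - j + 1 = card X - i" using assms(3) i by simp
    moreover have "?c * j \<le> card X choose i"
      using card_nsets_sum_eq_times_le[OF assms(1), of i t] i by simp
    ultimately show ?thesis using mult_le_mono1[of "?c * j" "card X choose i" "card X - i"]
      by (simp only: ac_simps)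
  qed
  also have "\<dots> = card X * ((card X - 1) choose i)"
    using binomial_absorb_comp[of "card X" i] by (simp add: mult.commute)
  also have "\<dots> = (card X choose j) * j"
    using binomial_absorption[of i "card X"] i by (simp add: mult.commute)
  finally show ?thesis using assms(2) by (simp only: mult_le_cancel2)
qed

text \<open>Passing to complements replaces the factor \<open>card X - j + 1\<close> by
  \<open>j + 1\<close>. The two factors add up to \<open>card X + 2\<close>, which makes the
  estimate uniform in \<open>j\<close>.\<close>

lemma card_nsets_sum_eq_le:
  fixes X :: "nat set"
  assumes "finite X" "0 < j" "j < card X"
  shows "card {Y \<in> nsets X j. \<Sum>Y = t} * card X \<le> 2 * (card X choose j)"
proof -
  let ?c = "card {Y \<in> nsets X j. \<Sum>Y = t}"
  have "?c \<le> card {Z \<in> nsets X (card X - j). \<Sum>Z = \<Sum>X - t}"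
  proof (rule card_inj_on_le[where f = "\<lambda>Y. X - Y"])
    show "inj_on (\<lambda>Y. X - Y) {Y \<in> nsets X j. \<Sum>Y = t}"
      by (rule inj_onI) (auto simp: nsets_def)
    show "(\<lambda>Y. X - Y) ` {Y \<in> nsets X j. \<Sum>Y = t} \<subseteq> {Z \<in> nsets X (card X - j). \<Sum>Z = \<Sum>X - t}"
      using assms by (auto simp: nsets_def card_Diff_subset sum_diff_nat)
    show "finite {Z \<in> nsets X (card X - j). \<Sum>Z = \<Sum>X - t}"
      using assms by (simp add: finite_imp_finite_nsets)
  qed
  then have "?c * (j + 1) \<le> card {Z \<in> nsets X (card X - j). \<Sum>Z = \<Sum>X - t} * (j + 1)"
    by (rule mult_le_mono1)
  also have "\<dots> \<le> card X choose j"
    using card_nsets_sum_eq_le_codegree[of X "card X - j" "\<Sum>X - t"] assms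
      binomial_symmetric[of j "card X"]
    by simp
  finally have 2: "?c * (j + 1) \<le> card X choose j" by simp
  have "?c * (card X - j + 1) + ?c * (j + 1) \<le> 2 * (card X choose j)"
    using 2 card_nsets_sum_eq_le_codegree[of X j t] assms by simp
  moreover have "?c * (card X - j + 1) + ?c * (j + 1) = ?c * (card X + 2)"
    using assms by (simp flip: distrib_left)
  ultimately show ?thesis by simp
qed

lemma card_nsets_sum_in_le:
  fixes X V :: "nat set"
  assumes "finite X" "0 < j" "j < card X" "finite V"
  shows "card {Y \<in> nsets X j. \<Sum>Y \<in> V} * card X \<le> 2 * card V * (card X choose j)"
proof -
  have "{Y \<in> nsets X j. \<Sum>Y \<in> V} = (\<Union>t\<in>V. {Y \<in> nsets X j. \<Sum>Y = t})" by auto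
  then have "card {Y \<in> nsets X j. \<Sum>Y \<in> V} \<le> (\<Sum>t\<in>V. card {Y \<in> nsets X j. \<Sum>Y = t})"
    using card_UN_le[OF assms(4), of "\<lambda>t. {Y \<in> nsets X j. \<Sum>Y = t}"] by simp
  then have "card {Y \<in> nsets X j. \<Sum>Y \<in> V} * card X
      \<le> (\<Sum>t\<in>V. card {Y \<in> nsets X j. \<Sum>Y = t}) * card X" by simp
  also have "\<dots> = (\<Sum>t\<in>V. card {Y \<in> nsets X j. \<Sum>Y = t} * card X)"
    by (rule sum_distrib_right)
  also have "\<dots> \<le> of_nat (card V) * (2 * (card X choose j))"
    using assms by (intro sum_bounded_above card_nsets_sum_eq_le) auto
  finally show ?thesis by simp
qed

section \<open>Subset sums dividing a fixed number\<close>

lemma divisors_ge: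
  fixes M :: nat and \<tau> :: real
  assumes "0 < M" "0 < \<tau>"
  shows "finite {t. t dvd M \<and> \<tau> \<le> real t}" "real (card {t. t dvd M \<and> \<tau> \<le> real t}) \<le> real M / \<tau>"
proof -
  let ?V = "{t. t dvd M \<and> \<tau> \<le> real t}"
  show fin: "finite ?V"
    using assms by (intro finite_subset[of ?V "{..M}"]) (auto dest: dvd_imp_le)
  \<comment> \<open>Large divisors have small cofactors: \<open>M div t\<close> is at most
    \<open>M / \<tau>\<close>, and it determines \<open>t\<close>.\<close>
  have "card ?V \<le> card {1..nat \<lfloor>real M / \<tau>\<rfloor>}"
  proof (rule card_inj_on_le[where f = "\<lambda>t. M div t"])
    show "inj_on (\<lambda>t. M div t) ?V"
    proof (rule inj_onI)
      fix t u assume "t \<in> ?V" "u \<in> ?V" and e: "M div t = M div u"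
      from this(1,2) have "t * (M div t) = M" "u * (M div u) = M"
        by (auto intro: dvd_mult_div_cancel)
      then have "t * (M div t) = u * (M div t)" "M div t \<noteq> 0"
        using assms(1) e by (auto intro!: Nat.gr0I)
      then show "t = u" by simp
    qed
    show "(\<lambda>t. M div t) ` ?V \<subseteq> {1..nat \<lfloor>real M / \<tau>\<rfloor>}"
    proof clarify
      fix t assume t: "t dvd M" "\<tau> \<le> real t"
      then obtain d where d: "M = t * d" by blast
      have "t > 0" "d > 0" using d assms(1) by auto
      have "real d \<le> real M / \<tau>" using t(2) d assms by (simp add: field_simps mult_left_mono)
      then have "int d \<le> \<lfloor>real M / \<tau>\<rfloor>" by (simp add: le_floor_iff)
      then show "M div t \<in> {1..nat \<lfloor>real M / \<tau>\<rfloor>}"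
        using d \<open>t > 0\<close> \<open>d > 0\<close> by auto
    qed
  qed simp
  then have "card ?V \<le> nat \<lfloor>real M / \<tau>\<rfloor>" by simp
  then have "real (card ?V) \<le> real (nat \<lfloor>real M / \<tau>\<rfloor>)" by simp
  also have "\<dots> \<le> real M / \<tau>" using assms by simp
  finally show "real (card ?V) \<le> real M / \<tau>" .
qed

text \<open>At most \<open>M / \<tau>\<close> values are admissible, and each is attained by at most
  a proportion \<open>2 / card X\<close> of the sets. The shift \<open>w\<close> accommodates an
  element adjoined to \<open>Y\<close>.\<close>

lemma card_nsets_sum_dvd_le:
  fixes X :: "nat set"
  assumes "finite X" "0 < j" "j < card X" "0 < M" "0 < \<tau>"
  shows "real (card {Y \<in> nsets X j. w + \<Sum>Y dvd M \<and> \<tau> \<le> real (w + \<Sum>Y)})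
    \<le> 2 * real M / (\<tau> * real (card X)) * real (card X choose j)"
proof -
  let ?W = "{t. t dvd M \<and> \<tau> \<le> real t}"
  let ?V = "{v. w + v \<in> ?W}"
  note W = divisors_ge[OF assms(4,5)]
  have "?V = (\<lambda>t. w + t) -` ?W" by auto
  then have fV: "finite ?V" and cV: "card ?V \<le> card ?W"
    using W(1) card_vimage_inj_on_le[of "\<lambda>t. w + t" UNIV ?W]
      finite_vimageI[OF W(1), of "\<lambda>t. w + t"] by simp_all
  have "card {Y \<in> nsets X j. \<Sum>Y \<in> ?V} * card X \<le> 2 * card ?V * (card X choose j)"
    using assms fV by (intro card_nsets_sum_in_le) auto
  from of_nat_mono[OF this, where 'a = real]
  have "real (card {Y \<in> nsets X j. \<Sum>Y \<in> ?V}) * real (card X) \<le> 2 * real (card ?V) * real (card X choose j)"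
    by (simp only: of_nat_mult of_nat_numeral)
  also have "\<dots> \<le> 2 * (real M / \<tau>) * real (card X choose j)"
    using cV W(2) by (intro mult_right_mono mult_left_mono) auto
  finally have "real (card {Y \<in> nsets X j. \<Sum>Y \<in> ?V}) \<le> 2 * (real M / \<tau>) * real (card X choose j) / real (card X)"
    using assms(3) by (subst pos_le_divide_eq) auto
  then show ?thesis by simp
qed

section \<open>First and second moments of subset sums\<close>

lemma sum_nsets_sum:
  fixes w :: "'a \<Rightarrow> real"
  assumes "finite X"
  shows "(\<Sum>B\<in>nsets X (Suc j). sum w B) = real ((card X - 1) choose j) * sum w X"
proof -
  have "(\<Sum>B\<in>nsets X (Suc j). sum w B) = (\<Sum>B\<in>nsets X (Suc j). \<Sum>x | x \<in> X \<and> x \<in> B. w x)"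
    by (intro sum.cong refl) (auto simp: nsets_def)
  also have "\<dots> = (\<Sum>x\<in>X. \<Sum>B | B \<in> nsets X (Suc j) \<and> x \<in> B. w x)"
    using assms by (intro sum.swap_restrict finite_imp_finite_nsets)
  also have "\<dots> = (\<Sum>x\<in>X. real ((card X - 1) choose j) * w x)"
    using assms by (intro sum.cong refl) (simp add: card_nsets_containing)
  finally show ?thesis by (simp add: sum_distrib_left)
qed

text \<open>Expanding one factor of the square over the elements \<open>x\<close> of
  \<open>B\<close> reduces the second moment to first moments over the sets containing
  \<open>x\<close>.\<close>

lemma sum_nsets_sum_square:
  fixes w :: "'a \<Rightarrow> real"
  assumes "finite X"
  shows "(\<Sum>B\<in>nsets X (Suc (Suc j)). (sum w B)\<^sup>2) =
    real ((card X - 1) choose Suc j) * (\<Sum>x\<in>X. (w x)\<^sup>2)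
    + real ((card X - 2) choose j) * ((sum w X)\<^sup>2 - (\<Sum>x\<in>X. (w x)\<^sup>2))"
proof -
  have "(\<Sum>B\<in>nsets X (Suc (Suc j)). (sum w B)\<^sup>2)
      = (\<Sum>B\<in>nsets X (Suc (Suc j)). \<Sum>x | x \<in> X \<and> x \<in> B. w x * sum w B)"
    by (intro sum.cong refl) (auto simp: nsets_def power2_eq_square sum_distrib_right[symmetric] Int_absorb1 Int_def[symmetric])
  also have "\<dots> = (\<Sum>x\<in>X. \<Sum>B | B \<in> nsets X (Suc (Suc j)) \<and> x \<in> B. w x * sum w B)"
    using assms by (intro sum.swap_restrict finite_imp_finite_nsets)
  also have "\<dots> = (\<Sum>x\<in>X. w x * (real ((card X - 1) choose Suc j) * w x
      + real ((card X - 2) choose j) * (sum w X - w x)))"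
  proof (intro sum.cong refl)
    fix x assume x: "x \<in> X"
    have "(\<Sum>B | B \<in> nsets X (Suc (Suc j)) \<and> x \<in> B. w x * sum w B)
        = (\<Sum>Y\<in>nsets (X - {x}) (Suc j). w x * sum w (insert x Y))"
      unfolding nsets_containing[OF x] by (subst sum.reindex[OF inj_on_insert_nsets]) simp
    also have "\<dots> = (\<Sum>Y\<in>nsets (X - {x}) (Suc j). w x * (w x + sum w Y))"
      by (intro sum.cong refl arg_cong2[where f = "(*)"] sum.insert) (auto simp: nsets_def)
    also have "\<dots> = w x * (real (card (nsets (X - {x}) (Suc j))) * w x + (\<Sum>Y\<in>nsets (X - {x}) (Suc j). sum w Y))"
      by (simp add: sum_distrib_left[symmetric] sum.distrib)
    also have "\<dots> = w x * (real ((card X - 1) choose Suc j) * w x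
      + real ((card X - 2) choose j) * (sum w X - w x))"
      using assms x by (simp add: sum_nsets_sum card_nsets sum_diff1 numeral_2_eq_2)
    finally show "(\<Sum>B | B \<in> nsets X (Suc (Suc j)) \<and> x \<in> B. w x * sum w B) = \<dots>" .
  qed
  also have "\<dots> = (\<Sum>x\<in>X. real ((card X - 1) choose Suc j) * (w x)\<^sup>2
      + real ((card X - 2) choose j) * (w x * sum w X) - real ((card X - 2) choose j) * (w x)\<^sup>2)"
    by (intro sum.cong refl) (simp add: algebra_simps power2_eq_square)
  also have "\<dots> = real ((card X - 1) choose Suc j) * (\<Sum>x\<in>X. (w x)\<^sup>2)
     + real ((card X - 2) choose j) * ((\<Sum>x\<in>X. w x) * sum w X) - real ((card X - 2) choose j) * (\<Sum>x\<in>X. (w x)\<^sup>2)"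
    by (simp add: sum.distrib sum_subtractf flip: sum_distrib_left sum_distrib_right)
  finally show ?thesis by (simp add: algebra_simps power2_eq_square)
qed

lemma sum_nsets_sum_square_le:
  fixes w :: "'a \<Rightarrow> real"
  assumes "finite X" "2 \<le> k" "2 \<le> card X"
  shows "(\<Sum>B\<in>nsets X k. (sum w B)\<^sup>2) \<le> real ((card X - 1) choose (k - 1))
    * ((\<Sum>x\<in>X. (w x)\<^sup>2) + real (k - 1) / real (card X - 1) * (sum w X)\<^sup>2)"
proof -
  define j where "j = k - 2"
  then have j: "k = Suc (Suc j)" using assms(2) by simp
  have "real (Suc j) * real ((card X - 1) choose Suc j) = real (card X - 1) * real ((card X - 2) choose j)"
    using arg_cong[OF binomial_absorption[of j "card X - 1"], of real]
    by (simp only: of_nat_mult diff_diff_left one_add_one)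
  then have c: "real ((card X - 2) choose j) = real ((card X - 1) choose Suc j) * (real (Suc j) / real (card X - 1))"
    using assms(3) by (simp add: field_simps)
  have "(\<Sum>B\<in>nsets X k. (sum w B)\<^sup>2) \<le> real ((card X - 1) choose Suc j) * (\<Sum>x\<in>X. (w x)\<^sup>2)
    + real ((card X - 2) choose j) * (sum w X)\<^sup>2"
    unfolding j sum_nsets_sum_square[OF assms(1)]
    by (intro add_left_mono mult_left_mono) (auto intro: sum_nonneg)
  then show ?thesis unfolding c j by (simp add: algebra_simps)
qed

text \<open>A reversed Markov inequality: no sum exceeds \<open>sum w X\<close>, so a mean of
  \<open>k / card X\<close> times this maximum forces a positive proportion of the sums above half
  the mean. No bound on individual weights enters.\<close>

lemma card_nsets_small_sum_le:
  fixes w :: "'a \<Rightarrow> real"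
  assumes "finite X" "0 < k" "k \<le> card X" "\<And>x. x \<in> X \<Longrightarrow> 0 \<le> w x" "0 < sum w X"
  shows "real (card {B \<in> nsets X k. sum w B < real k * sum w X / (2 * real (card X))})
    \<le> (1 - real k / (2 * real (card X))) * real (card X choose k)"
proof -
  let ?n = "card X" and ?W = "sum w X"
  let ?\<theta> = "real k / (2 * real ?n)"
  let ?S = "{B \<in> nsets X k. sum w B < real k * ?W / (2 * real ?n)}"
  let ?c = "real (card ?S)" and ?D = "real (?n choose k)"
  have n: "0 < ?n" using assms by simp
  have fin: "finite (nsets X k)" using assms(1) by (rule finite_imp_finite_nsets)
  have sub: "?S \<subseteq> nsets X k" by auto
  obtain j where j: "k = Suc j" using assms(2) gr0_implies_Suc by blast
  have "real k * ?D = real ?n * real ((?n - 1) choose j)"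
    using arg_cong[OF binomial_absorption[of j ?n], of real] unfolding j by (simp only: of_nat_mult)
  then have e: "real ((?n - 1) choose j) = 2 * ?\<theta> * ?D" using n by (simp add: field_simps)
  have "2 * ?\<theta> * ?D * ?W = (\<Sum>B\<in>nsets X k. sum w B)"
    unfolding j sum_nsets_sum[OF assms(1)] using e unfolding j by simp
  also have "\<dots> = (\<Sum>B\<in>?S. sum w B) + (\<Sum>B\<in>nsets X k - ?S. sum w B)"
    using sum.subset_diff[OF sub fin, of "sum w"] by simp
  also have "(\<Sum>B\<in>?S. sum w B) \<le> of_nat (card ?S) * (?\<theta> * ?W)"
    by (rule sum_bounded_above) auto
  also have "(\<Sum>B\<in>nsets X k - ?S. sum w B) \<le> of_nat (card (nsets X k - ?S)) * ?W"
    using assms by (intro sum_bounded_above sum_mono2) (auto simp: nsets_def)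
  also have "real (card (nsets X k - ?S)) = ?D - ?c"
    using card_Diff_subset[OF finite_subset[OF sub fin] sub] card_mono[OF fin sub] assms(1)
    by (simp add: card_nsets of_nat_diff)
  finally have "2 * ?\<theta> * ?D * ?W \<le> (?c * ?\<theta> + (?D - ?c)) * ?W" by (simp add: algebra_simps)
  then have *: "2 * ?\<theta> * ?D \<le> ?c * ?\<theta> + (?D - ?c)" using assms(5) by (simp only: mult_le_cancel_right; auto)
  have "?c \<le> ?D"
    using card_mono[OF fin sub] assms(1) by (simp add: card_nsets)
  then have "?c * ?\<theta> \<le> ?D * ?\<theta>" by (intro mult_right_mono) auto
  moreover have "c \<le> (1 - \<theta>) * D" if "2 * \<theta> * D \<le> c * \<theta> + (D - c)" "c * \<theta> \<le> D * \<theta>" for c \<theta> D :: real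
    using that by (simp add: algebra_simps)
  ultimately show ?thesis using * by blast
qed

text \<open>Markov's inequality for the square of the sum.\<close>

lemma card_nsets_large_sum_le:
  fixes w :: "'a \<Rightarrow> real"
  assumes "finite X" "2 \<le> k" "2 \<le> card X" "0 < \<theta>"
  shows "real (card {B \<in> nsets X k. \<theta> \<le> sum w B}) * \<theta>\<^sup>2 \<le> real ((card X - 1) choose (k - 1))
    * ((\<Sum>x\<in>X. (w x)\<^sup>2) + real (k - 1) / real (card X - 1) * (sum w X)\<^sup>2)"
proof -
  let ?S = "{B \<in> nsets X k. \<theta> \<le> sum w B}"
  have fin: "finite (nsets X k)" using assms(1) by (rule finite_imp_finite_nsets)
  have "of_nat (card ?S) * \<theta>\<^sup>2 \<le> (\<Sum>B\<in>?S. (sum w B)\<^sup>2)"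
    using assms(4) by (intro sum_bounded_below power_mono) auto
  also have "\<dots> \<le> (\<Sum>B\<in>nsets X k. (sum w B)\<^sup>2)"
    using fin by (intro sum_mono2) auto
  also note sum_nsets_sum_square_le[OF assms(1-3)]
  finally show ?thesis by simp
qed

text \<open>Chebyshev's inequality: a sum below half the mean \<open>\<mu>\<close> deviates from it
  by at least \<open>\<mu> / 2\<close>. The bound tends to 0 with the relative size
  \<open>K / sum w X\<close> of the largest weight.\<close>

lemma card_nsets_small_sum_le_Chebyshev:
  fixes w :: "'a \<Rightarrow> real"
  assumes "finite X" "2 \<le> k" "k \<le> card X" "\<And>x. x \<in> X \<Longrightarrow> 0 \<le> w x" "\<And>x. x \<in> X \<Longrightarrow> w x \<le> K"
    and W: "0 < sum w X"
  shows "real (card {B \<in> nsets X k. sum w B < real k * sum w X / (2 * real (card X))})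
    \<le> 4 * (K / sum w X) * (real (card X) / real k)\<^sup>2 * real (card X choose k)"
proof -
  let ?n = "card X" and ?W = "sum w X"
  define \<mu> where "\<mu> = real k * ?W / real ?n"
  let ?S = "{B \<in> nsets X k. sum w B < real k * ?W / (2 * real ?n)}"
  let ?D = "real (?n choose k)"
  let ?E = "real ((?n - 1) choose (k - 1))"
  have n: "0 < ?n" and k: "0 < k" and n2: "2 \<le> ?n" using assms by simp_all
  have \<mu>: "0 < \<mu>" using n k W by (simp add: \<mu>_def)
  have fin: "finite (nsets X k)" using assms(1) by (rule finite_imp_finite_nsets)
  obtain j where j: "k = Suc j" using k gr0_implies_Suc by blast
  have "real k * ?D = real ?n * ?E"
    using arg_cong[OF binomial_absorption[of j ?n], of real] unfolding j by (simp only: of_nat_mult diff_Suc_1)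
  then have DE: "?D = real ?n / real k * ?E" "?E = real k / real ?n * ?D" using n k by (simp_all add: field_simps)
  have first: "(\<Sum>B\<in>nsets X k. sum w B) = ?E * ?W"
    unfolding j by (simp add: sum_nsets_sum[OF assms(1)])
  have sq: "(\<Sum>x\<in>X. (w x)\<^sup>2) \<le> K * ?W"
    unfolding sum_distrib_left power2_eq_square
    using assms(4,5) by (intro sum_mono mult_right_mono) auto
  have K: "0 \<le> K" using assms(4,5) n by (metis all_not_in_conv card_gt_0_iff order_trans)
  have "of_nat (card ?S) * (\<mu> / 2)\<^sup>2 \<le> (\<Sum>B\<in>?S. (\<mu> - sum w B)\<^sup>2)"
  proof (intro sum_bounded_below power_mono)
    fix B assume "B \<in> ?S"
    then have "sum w B < \<mu> / 2" by (simp add: \<mu>_def field_simps)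
    then show "\<mu> / 2 \<le> \<mu> - sum w B" by simp
  qed (use \<mu> in auto)
  also have "\<dots> \<le> (\<Sum>B\<in>nsets X k. (\<mu> - sum w B)\<^sup>2)"
    using fin by (intro sum_mono2) auto
  also have "\<dots> = (\<Sum>B\<in>nsets X k. \<mu>\<^sup>2 - 2 * \<mu> * sum w B + (sum w B)\<^sup>2)"
    by (intro sum.cong refl) (simp add: power2_diff)
  also have "\<dots> = ?D * \<mu>\<^sup>2 - 2 * \<mu> * (?E * ?W) + (\<Sum>B\<in>nsets X k. (sum w B)\<^sup>2)"
    using assms(1) by (simp only: sum.distrib sum_subtractf sum_constant card_nsets first sum_distrib_left[symmetric])
  also have "\<dots> \<le> ?D * \<mu>\<^sup>2 - 2 * \<mu> * (?E * ?W) + ?E * (K * ?W + real (k - 1) / real (?n - 1) * ?W\<^sup>2)"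
    using order_trans[OF sum_nsets_sum_square_le[OF assms(1,2) n2, of w] mult_left_mono[OF add_right_mono[OF sq]]]
    by simp
  also have "real (k - 1) / real (?n - 1) * ?W\<^sup>2 \<le> real k / real ?n * ?W\<^sup>2"
    using assms(2,3) n2 by (intro mult_right_mono) (auto simp: field_simps of_nat_diff)
  \<comment> \<open>Since \<open>?E * ?W = ?D * \<mu>\<close>, the terms quadratic in
    \<open>\<mu>\<close> cancel and only the diagonal contribution survives.\<close>
  also have "?D * \<mu>\<^sup>2 - 2 * \<mu> * (?E * ?W) + ?E * (K * ?W + real k / real ?n * ?W\<^sup>2) = ?E * (K * ?W)"
    unfolding DE(1) \<mu>_def using n k by (simp add: field_simps power2_eq_square)
  also have "\<dots> \<le> ?D * (K * ?W)"
    unfolding DE(2) using assms(3) n K W by (intro mult_right_mono) (auto simp: field_simps)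
  finally have "real (card ?S) * (\<mu> / 2)\<^sup>2 \<le> ?D * (K * ?W)" by (simp add: mult_left_mono)
  then have "real (card ?S) \<le> ?D * (K * ?W) / (\<mu> / 2)\<^sup>2"
    using \<mu> by (subst pos_le_divide_eq) auto
  also have "\<dots> = 4 * (K / ?W) * (real ?n / real k)\<^sup>2 * ?D"
    using W n k by (simp add: \<mu>_def field_simps power2_eq_square)
  finally show ?thesis .
qed

section \<open>Simultaneous divisors, and elementary counting bounds\<close>

lemma common_shift_divisors:
  fixes M u v E :: nat
  assumes "0 < M" "0 < v" "v < u" and E: "M * (u - v) \<le> E * (u * v)"
  shows "finite {t. u + t dvd M \<and> v + t dvd M}" "card {t. u + t dvd M \<and> v + t dvd M} \<le> E"
proof -
  let ?V = "{t. u + t dvd M \<and> v + t dvd M}"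
  \<comment> \<open>The difference of the two cofactors equals
    \<open>M * (u - v) / ((u + t) * (v + t))\<close>. It is a positive integer, at most
    \<open>E\<close> and strictly decreasing in \<open>t\<close>, so it determines
    \<open>t\<close>.\<close>
  let ?f = "\<lambda>t. M div (v + t) - M div (u + t)"
  show "finite ?V"
    using assms(1) by (intro finite_subset[of ?V "{..M}"]) (auto dest: dvd_imp_le)
  have f: "?f t * ((u + t) * (v + t)) = M * (u - v)" if t: "t \<in> ?V" for t
  proof -
    have "M div (v + t) * (v + t) = M" "M div (u + t) * (u + t) = M" using t by auto
    then have "M div (v + t) * ((u + t) * (v + t)) = M * (u + t)"
      "M div (u + t) * ((u + t) * (v + t)) = M * (v + t)" by (metis mult.commute mult.assoc)+
    then have "?f t * ((u + t) * (v + t)) = M * (u + t) - M * (v + t)"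
      by (simp only: diff_mult_distrib)
    also have "\<dots> = M * (u - v)" by (simp add: diff_mult_distrib2[symmetric])
    finally show ?thesis .
  qed
  have pos: "0 < M * (u - v)" using assms by simp
  have "card ?V \<le> card {1..E}"
  proof (rule card_inj_on_le[where f = ?f])
    show "inj_on ?f ?V"
    proof (rule inj_onI)
      fix t t' assume t: "t \<in> ?V" "t' \<in> ?V" and e: "?f t = ?f t'"
      have "?f t * ((u + t) * (v + t)) = ?f t * ((u + t') * (v + t'))"
        using f[OF t(1)] f[OF t(2)] e by (simp only:)
      moreover have "?f t \<noteq> 0" using f[OF t(1)] pos by (metis mult_0 less_irrefl)
      ultimately have p: "(u + t) * (v + t) = (u + t') * (v + t')" by (simp only: mult_cancel1; auto)
      have mono: "(u + x) * (v + x) < (u + y) * (v + y)" if "x < y" for x y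
        using that assms by (intro mult_strict_mono) auto
      show "t = t'" using p mono[of t t'] mono[of t' t] by (cases t t' rule: linorder_cases) auto
    qed
    show "?f ` ?V \<subseteq> {1..E}"
    proof
      fix y assume "y \<in> ?f ` ?V"
      then obtain t where t: "t \<in> ?V" "y = ?f t" by blast
      have y: "y * ((u + t) * (v + t)) = M * (u - v)" using f[OF t(1)] t(2) by (simp only:)
      have "y \<noteq> 0" using y pos by (metis mult_0 less_irrefl)
      have "y * (u * v) \<le> y * ((u + t) * (v + t))" by (intro mult_le_mono) auto
      then have "y * (u * v) \<le> E * (u * v)" using y E by linarith
      then have "y \<le> E" using assms by (simp only: mult_le_cancel2; auto)
      with \<open>y \<noteq> 0\<close> show "y \<in> {1..E}" by simp
    qed
  qed simp
  then show "card ?V \<le> E" by simp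
qed

text \<open>Lowering \<open>m\<close> by one multiplies \<open>m choose j\<close> by
  \<open>(m - j) / m\<close>, which is at least \<open>7 / 8\<close> here, and the fourth power of
  \<open>8 / 7\<close> is below 2.\<close>

lemma binomial_le_twice:
  assumes "16 * Suc j \<le> N"
  shows "N choose j \<le> 2 * ((N - 4) choose j)"
proof -
  have step: "7 * (m choose j) \<le> 8 * ((m - 1) choose j)" if "8 * j \<le> m" for m
  proof (cases "m = 0")
    case False
    have "7 * m \<le> 8 * (m - j)" using that by simp
    then have "7 * m * (m choose j) \<le> 8 * ((m - j) * (m choose j))"
      by (metis mult.assoc mult_le_mono1)
    also have "\<dots> = m * (8 * ((m - 1) choose j))"
      using binomial_absorb_comp[of m j] by simp
    finally show ?thesis using False by (simp add: mult.assoc mult.left_commute[of _ m])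
  qed (use that in auto)
  have "7 * (N choose j) \<le> 8 * ((N - 1) choose j)" "7 * ((N - 1) choose j) \<le> 8 * ((N - 2) choose j)"
    "7 * ((N - 2) choose j) \<le> 8 * ((N - 3) choose j)" "7 * ((N - 3) choose j) \<le> 8 * ((N - 4) choose j)"
    using assms step[of N] step[of "N - 1"] step[of "N - 2"] step[of "N - 3"] by (simp_all add: numeral_eq_Suc)
  then show ?thesis by linarith
qed

lemma pigeonhole_bounded:
  fixes f :: "'a \<Rightarrow> nat"
  assumes "finite G" "\<And>x. x \<in> G \<Longrightarrow> f x \<le> L" "r * (L + 1) < card G"
  obtains y where "r < card {x \<in> G. f x = y}"
proof -
  have "\<exists>y. r < card {x \<in> G. f x = y}"
  proof (rule ccontr)
    assume "\<not> ?thesis"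
    then have *: "card {x \<in> G. f x = y} \<le> r" for y by (simp add: not_less)
    have "G = (\<Union>y\<in>{..L}. {x \<in> G. f x = y})" using assms(2) by auto
    then have "card G \<le> (\<Sum>y\<in>{..L}. card {x \<in> G. f x = y})"
      using card_UN_le[of "{..L}" "\<lambda>y. {x \<in> G. f x = y}"] by simp
    also have "\<dots> \<le> of_nat (card {..L}) * r" using * by (intro sum_bounded_above) auto
    finally show False using assms(3) by (simp add: mult.commute)
  qed
  then show ?thesis using that by blast
qed

lemma card_le_by_cover:
  assumes "F \<subseteq> G \<union> H" "finite G" "finite H"
  shows "real (card F) \<le> real (card G) + real (card H)"
proof -
  have "card F \<le> card (G \<union> H)" using assms by (intro card_mono) auto
  also have "\<dots> \<le> card G + card H" by (rule card_Un_le)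
  finally show ?thesis by simp
qed

subsection \<open>Counterexamples with a divisor containing the largest element\<close>

text \<open>The configuration to be refuted, with \<open>N = n - 1\<close>. The exponent 8 comes
  from the cluster argument, where the number of exceptional sums is of order \<open>q ^ 4\<close>
  with \<open>q\<close> quadratic in \<open>s\<close>; \<open>2 ^ 40\<close> leaves room in every
  case.\<close>

locale many_divisors =
  fixes s k N :: nat and A :: "nat set"
  assumes s_pos: "0 < s" and fin_A: "finite A" and zero_notin: "0 \<notin> A" and card_A: "card A = Suc N"
    and k_ge: "2 \<le> k" and k_less: "k < N"
    and many: "N choose k \<le> num_s_divisors s k A"
    and meets_Max: "\<exists>B \<in> k_s_divisors k s A. Max A \<in> B"
    and N_large: "2 ^ 40 * (s + 1) ^ 8 \<le> N"
begin

definition "a = Max A"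
definition "A' = A - {a}"
definition "M = s * \<Sum>A"
definition "F0 = {B \<in> nsets A' k. \<Sum>B dvd M}"
definition "F1 = {B \<in> nsets A k. a \<in> B \<and> \<Sum>B dvd M}"

lemma a_in: "a \<in> A" and a_ge: "x \<in> A \<Longrightarrow> x \<le> a"
  using fin_A card_A unfolding a_def by (auto intro: Max_in)

lemma fin_A': "finite A'" and card_A': "card A' = N"
  using fin_A card_A a_in by (auto simp: A'_def)

lemma pos: "x \<in> A \<Longrightarrow> 0 < x"
  using zero_notin by (metis gr0I)

lemma sum_A: "\<Sum>A = a + \<Sum>A'"
  unfolding A'_def using sum.remove[OF fin_A a_in, of "\<lambda>x. x"] .

lemma sum_A_pos: "0 < \<Sum>A"
  using sum_A pos[OF a_in] by simp

lemma M_pos: "0 < M"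
  using s_pos sum_A_pos by (simp add: M_def)

lemma k_s_divisors_eq: "k_s_divisors k s A = {B \<in> nsets A k. \<Sum>B dvd M}"
  by (auto simp: k_s_divisors_def s_divisor_def M_def nsets_def)

lemma fin_F: "finite F0" "finite F1"
  unfolding F0_def F1_def using fin_A fin_A' by (simp_all add: finite_imp_finite_nsets)

lemma F0_Un_F1: "k_s_divisors k s A = F0 \<union> F1"
  unfolding k_s_divisors_eq F0_def F1_def A'_def by (auto simp: nsets_def)

lemma card_F0_F1: "N choose k \<le> card F0 + card F1"
  using many card_Un_le[of F0 F1] unfolding num_s_divisors_def F0_Un_F1 by linarith

text \<open>\<open>B\<close> is a proper subset of \<open>A\<close>, so
  \<open>\<Sum>B < \<Sum>A\<close> and the cofactor of \<open>\<Sum>B\<close> in \<open>M\<close>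
  exceeds \<open>s\<close>.\<close>

lemma divisor_sum_le:
  assumes "B \<in> nsets A k" "\<Sum>B dvd M"
  shows "(s + 1) * \<Sum>B \<le> M"
proof -
  obtain d where d: "M = \<Sum>B * d" using assms(2) by blast
  have B: "B \<subseteq> A" "card B = k" using assms(1) by (auto simp: nsets_def)
  then have "A - B \<noteq> {}" using card_A k_less by (metis Diff_eq_empty_iff Suc_n_not_le_n card_mono fin_A finite_subset less_le_not_le not_less_eq_eq subset_antisym less_imp_le)
  then obtain x where x: "x \<in> A" "x \<notin> B" by blast
  have "\<Sum>B + x \<le> \<Sum>A"
    using sum_mono2[of A "insert x B" "\<lambda>x. x"] fin_A x B finite_subset[OF B(1) fin_A] by simp
  then have "\<Sum>B < \<Sum>A" using pos[OF x(1)] by simp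
  then have "s * \<Sum>B < M" using s_pos by (simp add: M_def)
  then have "\<Sum>B * s < \<Sum>B * d" using d by (simp only: mult.commute)
  then have "s + 1 \<le> d" by simp
  then show ?thesis unfolding d by (simp only: mult.commute[of "\<Sum>B"] mult_le_mono1)
qed

text \<open>This is where a divisor containing the largest element is used: it keeps that element from
  dominating the total.\<close>

lemma sum_A_le: "\<Sum>A \<le> (s + 1) * \<Sum>A'"
proof -
  obtain B where B: "B \<in> nsets A k" "\<Sum>B dvd M" "a \<in> B"
    using meets_Max unfolding k_s_divisors_eq a_def by blast
  then have "a \<le> \<Sum>B" using member_le_sum[of a B "\<lambda>x. x"] by (auto simp: nsets_def)
  then have "(s + 1) * a \<le> M" using divisor_sum_le[OF B(1,2)] by (meson le_trans mult_le_mono2)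
  \<comment> \<open>Cancelling \<open>s * a\<close> in
    \<open>(s + 1) * a \<le> s * (a + \<Sum>A')\<close> leaves
    \<open>a \<le> s * \<Sum>A'\<close>.\<close>
  then show ?thesis by (simp add: M_def sum_A algebra_simps)
qed

lemma sum_A'_pos: "0 < \<Sum>A'"
  using sum_A_le sum_A_pos by (cases "\<Sum>A' = 0") auto

lemma s_power_le: "i \<le> 8 \<Longrightarrow> real (s + 1) ^ i \<le> real (s + 1) ^ 8"
  by (rule power_increasing) auto

lemma N_ge: "i \<le> 8 \<Longrightarrow> 2 ^ 40 * real (s + 1) ^ i \<le> real N"
proof -
  assume "i \<le> 8"
  have "2 ^ 40 * real (s + 1) ^ i \<le> 2 ^ 40 * real (s + 1) ^ 8"
    using s_power_le[OF \<open>i \<le> 8\<close>] by (rule mult_left_mono) simp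
  also have "\<dots> = real (2 ^ 40 * (s + 1) ^ 8)" by (simp only: of_nat_mult of_nat_power of_nat_numeral)
  also have "\<dots> \<le> real N" using N_large by (simp only: of_nat_le_iff)
  finally show ?thesis .
qed

lemma N_pos: "0 < N"
  using k_less by simp

text \<open>Removing \<open>a\<close> leaves a \<open>(k - 1)\<close>-subset of \<open>A'\<close>.
  The summand \<open>a\<close> alone lifts every sum to at least \<open>\<tau>\<close>, so only
  large divisors of \<open>M\<close> compete.\<close>

lemma card_F1_le:
  assumes "0 < \<tau>" "\<tau> \<le> real a"
  shows "real (card F1) \<le> 2 * real M / (\<tau> * real N) * real (N choose (k - 1))"
proof -
  have k: "Suc (k - 1) = k" using k_ge by simp
  have "card F1 \<le> card {Y \<in> nsets A' (k - 1). a + \<Sum>Y dvd M}"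
    using card_nsets_containing_sum_le[OF fin_A a_in, of "k - 1" "\<lambda>t. t dvd M"]
    unfolding k F1_def A'_def .
  also have "{Y \<in> nsets A' (k - 1). a + \<Sum>Y dvd M}
      = {Y \<in> nsets A' (k - 1). a + \<Sum>Y dvd M \<and> \<tau> \<le> real (a + \<Sum>Y)}"
  proof -
    have "\<tau> \<le> real (a + t)" for t using assms(2) by simp
    then show ?thesis by blast
  qed
  finally have "real (card F1) \<le> real (card {Y \<in> nsets A' (k - 1). a + \<Sum>Y dvd M \<and> \<tau> \<le> real (a + \<Sum>Y)})"
    by simp
  also have "\<dots> \<le> 2 * real M / (\<tau> * real (card A')) * real (card A' choose (k - 1))"
    using k_ge k_less card_A' fin_A' M_pos assms(1) by (intro card_nsets_sum_dvd_le) auto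
  finally show ?thesis by (simp only: card_A')
qed

section \<open>Counterexamples with \<open>k\<close> at least a fixed proportion of
  \<open>N\<close>\<close>

lemma card_F0_le:
  "real (card F0) \<le> (1 - real k / (2 * real N) + 4 * real s * real (s + 1) / real k) * real (N choose k)"
proof -
  let ?T = "sum real A'"
  have T: "?T = real (\<Sum>A')" by simp
  have Tpos: "0 < ?T" unfolding T using sum_A'_pos by (simp only: of_nat_0_less_iff)
  \<comment> \<open>Half the mean sum of a \<open>k\<close>-subset of \<open>A'\<close>. Sets below
    it are controlled by the reversed Markov inequality, sets above it by the scarcity of large
    divisors; \<open>sum_A_le\<close> bounds \<open>M\<close> in terms of
    \<open>\<Sum>A'\<close>.\<close>
  define \<tau> where "\<tau> = real k * ?T / (2 * real N)"
  have k: "0 < real k" and N: "0 < real N" using k_ge k_less by simp_all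
  have \<tau>: "0 < \<tau>" unfolding \<tau>_def using Tpos k N by simp
  let ?G = "{B \<in> nsets A' k. sum real B < real k * ?T / (2 * real (card A'))}"
  let ?H = "{B \<in> nsets A' k. 0 + \<Sum>B dvd M \<and> \<tau> \<le> real (0 + \<Sum>B)}"
  have "F0 \<subseteq> ?G \<union> ?H"
    unfolding F0_def \<tau>_def card_A' by auto
  then have "real (card F0) \<le> real (card ?G) + real (card ?H)"
    using fin_A' by (intro card_le_by_cover) (auto simp: finite_imp_finite_nsets)
  also have "real (card ?G) \<le> (1 - real k / (2 * real (card A'))) * real (card A' choose k)"
    using fin_A' k_ge k_less card_A' Tpos by (intro card_nsets_small_sum_le) auto
  also have "real (card ?H) \<le> 2 * real M / (\<tau> * real (card A')) * real (card A' choose k)"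
    using k_ge k_less card_A' fin_A' M_pos \<tau> by (intro card_nsets_sum_dvd_le) auto
  also have "2 * real M / (\<tau> * real (card A')) \<le> 4 * real s * real (s + 1) / real k"
  proof -
    have "real (\<Sum>A) \<le> real (s + 1) * ?T"
      using of_nat_mono[OF sum_A_le, where 'a = real] unfolding T by (simp only: of_nat_mult)
    then have "real M \<le> real s * (real (s + 1) * ?T)"
      unfolding M_def of_nat_mult by (intro mult_left_mono) auto
    have "2 * real M / (\<tau> * real (card A')) = 4 * real M / (real k * ?T)"
      unfolding card_A' \<tau>_def using N by (simp add: field_simps)
    also have "\<dots> \<le> 4 * (real s * (real (s + 1) * ?T)) / (real k * ?T)"
      using \<open>real M \<le> _\<close> k Tpos by (intro divide_right_mono) auto
    also have "\<dots> = 4 * real s * real (s + 1) / real k"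
      using Tpos by simp
    finally show ?thesis .
  qed
  finally show ?thesis unfolding card_A' by (simp add: algebra_simps mult_right_mono)
qed

text \<open>Here \<open>k / (2 * N)\<close> is at least \<open>1 / 32\<close> and the error term of
  \<open>card_F0_le\<close> at most \<open>1 / 64\<close>, so \<open>F0\<close> misses a proportion
  \<open>1 / 64\<close> of the \<open>k\<close>-subsets of \<open>A'\<close>, which
  \<open>F1\<close> must make up for.\<close>

lemma card_F1_ge:
  assumes "N \<le> 16 * k"
  shows "real (N choose k) / 64 \<le> real (card F1)"
proof -
  have k: "0 < real k" and N: "0 < real N" using k_ge k_less by simp_all
  have Nk: "real N \<le> 16 * real k" using assms by linarith
  have "4 * real s * real (s + 1) \<le> 4 * real (s + 1) ^ 2"
    by (simp add: power2_eq_square algebra_simps)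
  also have "\<dots> \<le> real N / 1024" using N_ge[of 2] by simp
  also have "\<dots> \<le> real k / 64" using Nk by simp
  finally have "4 * real s * real (s + 1) / real k \<le> 1 / 64" using k by (simp add: field_simps)
  moreover have "1 / 32 \<le> real k / (2 * real N)" using Nk N by (simp add: field_simps)
  ultimately have "1 - real k / (2 * real N) + 4 * real s * real (s + 1) / real k \<le> 1 - 1 / 64" by linarith
  then have "real (card F0) \<le> (1 - 1 / 64) * real (N choose k)"
    using card_F0_le mult_right_mono[of _ _ "real (N choose k)"] by (meson of_nat_0_le_iff order_trans)
  then show ?thesis using of_nat_mono[OF card_F0_F1, where 'a = real] by simp
qed

lemma choose_pos: "0 < real (N choose k)"
  using k_less by simp

lemma choose_k_minus_1: "real (N choose (k - 1)) * real (N + 1 - k) = real k * real (N choose k)"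
proof -
  obtain j where j: "k = Suc j" using k_ge by (cases k) auto
  have "(N - j) * (N choose j) = Suc j * (N choose Suc j)"
    using binomial_absorb_comp[of N j] binomial_absorption[of j N] by simp
  moreover have "N + 1 - k = N - j" using j by simp
  ultimately have "(N choose (k - 1)) * (N + 1 - k) = k * (N choose k)"
    using j by (simp add: mult.commute)
  then show ?thesis by (metis of_nat_mult)
qed

text \<open>A dominant \<open>a\<close> makes \<open>F1\<close> too small for
  \<open>card_F1_ge\<close>; without one, Chebyshev's inequality makes all divisors together too
  few. The lower bound on \<open>N + 1 - k\<close> keeps \<open>N choose (k - 1)\<close> and
  \<open>N + 1 choose k\<close> within a factor \<open>1 / \<epsilon>\<close> of
  \<open>N choose k\<close>.\<close>

lemma middle_range:
  assumes "N \<le> 16 * k" and \<epsilon>: "\<epsilon> = 1 / (256 * real (s + 1) ^ 2)"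
    and m: "\<epsilon> * real (N + 1) \<le> real (N + 1 - k)"
  shows False
proof -
  have k: "0 < real k" and N: "0 < real N" using k_ge k_less by simp_all
  have Nk: "real N \<le> 16 * real k" using assms by linarith
  have \<epsilon>0: "0 < \<epsilon>" unfolding \<epsilon> by simp
  \<comment> \<open>Chosen so that the Chebyshev bound \<open>4 * c * 32\<^sup>2\<close> becomes
    \<open>\<epsilon> / 2\<close>, where 32 bounds \<open>(N + 1) / k\<close>.\<close>
  define c where "c = \<epsilon> / 8192"
  let ?S = "sum real A"
  have S: "?S = real (\<Sum>A)" by simp
  have Spos: "0 < ?S" unfolding S using sum_A_pos by (simp only: of_nat_0_less_iff)
  have MS: "real M = real s * ?S" unfolding M_def S of_nat_mult ..
  have c0: "0 < c" using \<epsilon>0 by (simp add: c_def)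
  have s_le: "real s \<le> real (s + 1)" by simp
  have D: "0 < real (N choose k)" by (rule choose_pos)
  show False
  proof (cases "c * ?S \<le> real a")
    case True
    have "real (card F1) \<le> 2 * real M / (c * ?S * real N) * real (N choose (k - 1))"
      using True c0 Spos by (intro card_F1_le) auto
    also have "2 * real M / (c * ?S * real N) = 2 * real s / (c * real N)"
      unfolding MS using Spos by simp
    also have "2 * real s / (c * real N) * real (N choose (k - 1))
        \<le> 2 * real s / (c * real N) * (real (N choose k) / \<epsilon>)"
    proof (rule mult_left_mono)
      have "real (N choose (k - 1)) * (\<epsilon> * real (N + 1)) \<le> real k * real (N choose k)"
        unfolding choose_k_minus_1[symmetric] using m by (intro mult_left_mono) auto
      also have "\<dots> \<le> real (N + 1) * real (N choose k)"
        using k_less by (intro mult_right_mono) auto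
      finally have "(real (N choose (k - 1)) * \<epsilon>) * real (N + 1) \<le> real (N choose k) * real (N + 1)"
        by (simp only: ac_simps)
      then have "real (N choose (k - 1)) * \<epsilon> \<le> real (N choose k)"
        by (simp only: mult_le_cancel_right; simp)
      then show "real (N choose (k - 1)) \<le> real (N choose k) / \<epsilon>"
        using \<epsilon>0 by (simp add: field_simps)
    qed (use c0 in simp)
    also have "\<dots> = (2 * real s / (c * \<epsilon> * real N)) * real (N choose k)" by simp
    also have "\<dots> < (1 / 64) * real (N choose k)"
    proof (rule mult_strict_right_mono[OF _ D])
      have "128 * real s / (c * \<epsilon>) = 2 ^ 36 * (real s * real (s + 1) ^ 4)"
        unfolding c_def \<epsilon> by (simp add: field_simps)
      also have "\<dots> \<le> 2 ^ 36 * (real (s + 1) * real (s + 1) ^ 4)"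
        by (intro mult_left_mono mult_right_mono s_le) auto
      also have "\<dots> = 2 ^ 36 * real (s + 1) ^ 5" by (simp only: power_Suc[symmetric]) simp
      also have "\<dots> < 2 ^ 40 * real (s + 1) ^ 5" by (intro mult_strict_right_mono) auto
      also have "\<dots> \<le> real N" by (rule N_ge) simp
      finally show "2 * real s / (c * \<epsilon> * real N) < 1 / 64"
        using c0 \<epsilon>0 N by (simp add: field_simps)
    qed
    finally show False using card_F1_ge[OF assms(1)] by simp
  next
    case False
    define \<tau> where "\<tau> = real k * ?S / (2 * real (N + 1))"
    have \<tau>: "0 < \<tau>" unfolding \<tau>_def using Spos k by simp
    let ?G = "{B \<in> nsets A k. sum real B < real k * ?S / (2 * real (card A))}"
    let ?H = "{B \<in> nsets A k. 0 + \<Sum>B dvd M \<and> \<tau> \<le> real (0 + \<Sum>B)}"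
    let ?C = "real (N + 1 choose k)"
    have cA: "card A = N + 1" using card_A by simp
    \<comment> \<open>A divisor has sum below half the mean or is a large divisor of
      \<open>M\<close>. Each class turns out to take at most \<open>\<epsilon> / 2\<close> of the
      \<open>k\<close>-subsets of \<open>A\<close>.\<close>
    have "k_s_divisors k s A \<subseteq> ?G \<union> ?H"
      unfolding k_s_divisors_eq \<tau>_def cA by auto
    then have "real (card (k_s_divisors k s A)) \<le> real (card ?G) + real (card ?H)"
      using fin_A by (intro card_le_by_cover) (auto simp: finite_imp_finite_nsets)
    also have "real (card ?G) \<le> 4 * (c * ?S / ?S) * (real (card A) / real k)\<^sup>2 * real (card A choose k)"
    proof (rule card_nsets_small_sum_le_Chebyshev)
      show "real x \<le> c * ?S" if "x \<in> A" for x using False a_ge[OF that] by linarith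
    qed (use fin_A k_ge k_less cA Spos in auto)
    also have "\<dots> = 4 * c * (real (N + 1) / real k)\<^sup>2 * ?C" using Spos cA by simp
    also have "\<dots> \<le> 4 * c * 32\<^sup>2 * ?C"
      using c0 k Nk k_ge by (intro mult_right_mono mult_left_mono power_mono) (auto simp: field_simps)
    also have "real (card ?H) \<le> 2 * real M / (\<tau> * real (card A)) * real (card A choose k)"
      using k_ge k_less cA fin_A M_pos \<tau> by (intro card_nsets_sum_dvd_le) auto
    also have "2 * real M / (\<tau> * real (card A)) = 4 * real s / real k"
    proof -
      have "2 * (\<sigma> * t) / (\<kappa> * t / (2 * n) * n) = 4 * \<sigma> / \<kappa>" if "0 < t" "0 < \<kappa>" "0 < n" for \<sigma> t \<kappa> n :: real
        using that by (simp add: field_simps)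
      from this[OF Spos k, of "real (N + 1)"] show ?thesis unfolding cA \<tau>_def MS by (simp only: of_nat_0_less_iff zero_less_Suc Suc_eq_plus1[symmetric])
    qed
    also have "4 * c * 32\<^sup>2 * ?C = \<epsilon> / 2 * ?C" by (simp add: c_def)
    also have "4 * real s / real k * real (card A choose k) < \<epsilon> / 2 * ?C"
    proof -
      have "128 * real s / \<epsilon> = 2 ^ 15 * (real s * real (s + 1) ^ 2)"
        unfolding \<epsilon> by simp
      also have "\<dots> \<le> 2 ^ 15 * (real (s + 1) * real (s + 1) ^ 2)"
        by (intro mult_left_mono mult_right_mono s_le) auto
      also have "\<dots> = 2 ^ 15 * real (s + 1) ^ 3" by (simp only: power_Suc[symmetric]) simp
      also have "\<dots> < 2 ^ 40 * real (s + 1) ^ 3" by (intro mult_strict_right_mono) auto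
      also have "\<dots> \<le> real N" by (rule N_ge) simp
      finally have "128 * real s < \<epsilon> * real N" using \<epsilon>0 by (simp add: field_simps)
      also have "\<dots> \<le> \<epsilon> * (16 * real k)" using Nk \<epsilon>0 by (intro mult_left_mono) auto
      finally have "4 * real s / real k < \<epsilon> / 2" using k by (simp add: field_simps)
      moreover have "0 < ?C" using k_less by simp
      ultimately show ?thesis unfolding cA by (rule mult_strict_right_mono)
    qed
    finally have "real (card (k_s_divisors k s A)) < \<epsilon> * ?C" by (simp add: cA)
    \<comment> \<open>\<open>N choose k\<close> is the fraction \<open>(N + 1 - k) / (N + 1)\<close>
      of \<open>N + 1 choose k\<close>, and this fraction is at least
      \<open>\<epsilon>\<close>.\<close>
    also have "\<dots> \<le> real (N choose k)"
    proof -
      have "real (N + 1 - k) * ?C = real (N + 1) * real (N choose k)"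
        using arg_cong[OF binomial_absorb_comp[of "N + 1" k], of real] by (simp only: of_nat_mult add_diff_cancel_right')
      moreover have "\<epsilon> * real (N + 1) * ?C \<le> real (N + 1 - k) * ?C"
        using m by (intro mult_right_mono) auto
      ultimately have "(\<epsilon> * ?C) * real (N + 1) \<le> real (N choose k) * real (N + 1)" by (simp only: ac_simps)
      then show ?thesis by (simp only: mult_le_cancel_right; simp)
    qed
    finally show False using many unfolding num_s_divisors_def by simp
  qed
qed

text \<open>A complement of a divisor is a small set with sum at least
  \<open>\<Sum>A / (s + 1)\<close>. It either contains a large element or reaches this sum from
  small elements only, which the second moment makes rare. Both classes stay within
  \<open>1 / 128\<close> of \<open>N choose k\<close>, the first strictly, against
  \<open>card_F1_ge\<close>.\<close>

lemma large_range:
  assumes \<epsilon>: "\<epsilon> = 1 / (256 * real (s + 1) ^ 2)"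
    and m: "real (N + 1 - k) < \<epsilon> * real (N + 1)"
  shows False
proof -
  have N: "0 < real N" and k: "0 < real k" using k_ge k_less by simp_all
  have \<epsilon>0: "0 < \<epsilon>" unfolding \<epsilon> by simp
  have one_le: "1 \<le> real (s + 1) ^ i" for i by (rule one_le_power) simp
  have \<epsilon>1: "\<epsilon> \<le> 1 / 256"
    unfolding \<epsilon> using one_le[of 2] by (intro divide_left_mono) auto
  have D: "0 < real (N choose k)" by (rule choose_pos)
  have mid: "N \<le> 16 * k"
  proof -
    have "real (N + 1) - real k = real (N + 1 - k)" using k_less by (simp add: of_nat_diff)
    also note m
    also have "\<epsilon> * real (N + 1) \<le> 1 / 256 * real (N + 1)" using \<epsilon>1 by (rule mult_right_mono) simp
    finally have "real N \<le> real (16 * k)" by simp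
    then show ?thesis by (simp only: of_nat_le_iff)
  qed
  let ?S = "sum real A"
  have S: "?S = real (\<Sum>A)" by simp
  have Spos: "0 < ?S" unfolding S using sum_A_pos by (simp only: of_nat_0_less_iff)
  have MS: "real M = real s * ?S" unfolding M_def S of_nat_mult ..
  define L where "L = {x \<in> A. \<epsilon> * ?S \<le> real x}"
  \<comment> \<open>Complements avoiding \<open>L\<close> keep their sum under \<open>w\<close>,
    while the truncation makes the sum of squared weights small.\<close>
  define w where "w x = (if x \<in> L then 0 else real x)" for x
  have finL: "finite L" unfolding L_def using fin_A by simp
  let ?G = "{B \<in> F1. \<exists>l \<in> L - {a}. l \<notin> B}"
  let ?H = "{B \<in> F1. (A - B) \<inter> L = {}}"
  have "F1 \<subseteq> ?G \<union> ?H" unfolding F1_def L_def by blast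
  then have cover: "real (card F1) \<le> real (card ?G) + real (card ?H)"
    using fin_F by (intro card_le_by_cover) auto

  have cardL: "real (card L) * \<epsilon> \<le> 1"
  proof -
    have "real (card L) * (\<epsilon> * ?S) \<le> sum real L"
      by (rule sum_bounded_below) (auto simp: L_def)
    also have "\<dots> \<le> ?S" using fin_A by (intro sum_mono2) (auto simp: L_def)
    finally have "(real (card L) * \<epsilon>) * ?S \<le> 1 * ?S" by simp
    then show ?thesis using Spos by (simp only: mult_le_cancel_right; simp)
  qed

  have G1: "real (card {B \<in> F1. l \<notin> B}) \<le> 2 * real s / (\<epsilon> * real (N - 1)) * real (N choose k)"
    if l: "l \<in> L - {a}" for l
  proof -
    \<comment> \<open>\<open>a\<close> is at least the large element \<open>l\<close>, so every sum
      containing \<open>a\<close> reaches the threshold.\<close>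
    have aS: "\<epsilon> * ?S \<le> real a"
      using l a_ge[of l] unfolding L_def by (auto intro: order_trans)
    have al: "a \<in> A - {l}" using l a_in by auto
    have Sk: "Suc (k - 1) = k" using k_ge by simp
    let ?X = "A - {l} - {a}"
    have cX: "card ?X = N - 1" using l al fin_A card_A a_in by (auto simp: L_def)
    have "{B \<in> F1. l \<notin> B} = {B \<in> nsets (A - {l}) k. a \<in> B \<and> \<Sum>B dvd M}"
      unfolding F1_def nsets_def by auto
    then have "card {B \<in> F1. l \<notin> B} \<le> card {Y \<in> nsets ?X (k - 1). a + \<Sum>Y dvd M}"
      using card_nsets_containing_sum_le[of "A - {l}" a "k - 1" "\<lambda>t. t dvd M"] fin_A al Sk by simp
    also have "{Y \<in> nsets ?X (k - 1). a + \<Sum>Y dvd M}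
        = {Y \<in> nsets ?X (k - 1). a + \<Sum>Y dvd M \<and> \<epsilon> * ?S \<le> real (a + \<Sum>Y)}"
    proof -
      have "\<epsilon> * ?S \<le> real (a + t)" for t using aS by simp
      then show ?thesis by blast
    qed
    finally have "real (card {B \<in> F1. l \<notin> B})
        \<le> real (card {Y \<in> nsets ?X (k - 1). a + \<Sum>Y dvd M \<and> \<epsilon> * ?S \<le> real (a + \<Sum>Y)})"
      by simp
    also have "\<dots> \<le> 2 * real M / (\<epsilon> * ?S * real (card ?X)) * real (card ?X choose (k - 1))"
    proof (rule card_nsets_sum_dvd_le)
      show "0 < k - 1" "k - 1 < card ?X" using k_ge k_less unfolding cX by simp_all
    qed (use fin_A M_pos \<epsilon>0 Spos in auto)
    also have "2 * real M / (\<epsilon> * ?S * real (card ?X)) = 2 * real s / (\<epsilon> * real (N - 1))"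
      unfolding MS cX using Spos by simp
    also have "2 * real s / (\<epsilon> * real (N - 1)) * real (card ?X choose (k - 1))
        \<le> 2 * real s / (\<epsilon> * real (N - 1)) * real (N choose k)"
    proof (rule mult_left_mono)
      \<comment> \<open>With \<open>l\<close> removed besides \<open>a\<close>, the count is
        \<open>(N - 1) choose (k - 1)\<close>, a Pascal summand of \<open>N choose k\<close>.
        Removing \<open>a\<close> alone would give \<open>N choose (k - 1)\<close>, which is far
        larger when \<open>k\<close> is close to \<open>N\<close>.\<close>
      have "N choose k = ((N - 1) choose (k - 1)) + ((N - 1) choose k)"
        using k_ge N_pos by (intro choose_reduce_nat) auto
      then show "real (card ?X choose (k - 1)) \<le> real (N choose k)" unfolding cX by simp
    qed (use \<epsilon>0 in simp)
    finally show ?thesis .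
  qed
  have G: "real (card ?G) < 1 / 128 * real (N choose k)"
  proof -
    have "?G = (\<Union>l\<in>L - {a}. {B \<in> F1. l \<notin> B})" by blast
    then have "card ?G \<le> (\<Sum>l\<in>L - {a}. card {B \<in> F1. l \<notin> B})"
      using card_UN_le[of "L - {a}" "\<lambda>l. {B \<in> F1. l \<notin> B}"] finL by simp
    then have "real (card ?G) \<le> (\<Sum>l\<in>L - {a}. real (card {B \<in> F1. l \<notin> B}))"
      by (simp flip: of_nat_sum)
    also have "\<dots> \<le> real (card (L - {a})) * (2 * real s / (\<epsilon> * real (N - 1)) * real (N choose k))"
      by (rule sum_bounded_above) (rule G1)
    also have "\<dots> \<le> (1 / \<epsilon>) * (2 * real s / (\<epsilon> * real (N - 1)) * real (N choose k))"
    proof (rule mult_right_mono)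
      have "card (L - {a}) \<le> card L" using finL by (intro card_mono) auto
      then show "real (card (L - {a})) \<le> 1 / \<epsilon>" using cardL \<epsilon>0 by (simp add: field_simps) (meson mult_left_mono of_nat_mono order_trans less_imp_le)
    qed (use \<epsilon>0 in simp)
    also have "\<dots> = (2 * real s / (\<epsilon>\<^sup>2 * real (N - 1))) * real (N choose k)"
      by (simp add: power2_eq_square)
    also have "\<dots> < 1 / 128 * real (N choose k)"
    proof (rule mult_strict_right_mono[OF _ D])
      have "256 * real s / \<epsilon>\<^sup>2 = 2 ^ 24 * (real s * real (s + 1) ^ 4)"
        unfolding \<epsilon> by (simp add: power_divide power_mult_distrib flip: power_mult)
      also have "\<dots> \<le> 2 ^ 24 * (real (s + 1) * real (s + 1) ^ 4)"
        by (intro mult_left_mono mult_right_mono) auto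
      also have "\<dots> = 2 ^ 24 * real (s + 1) ^ 5" by (simp only: power_Suc[symmetric]) simp
      also have "\<dots> < real N - 1"
      proof -
        have "2 ^ 24 * x < y - 1" if "2 ^ 40 * x \<le> y" "1 \<le> x" for x y :: real
          using that by simp
        from this[OF N_ge[of 5] one_le[of 5]] show ?thesis by simp
      qed
      also have "\<dots> = real (N - 1)" using N_pos by simp
      finally have "256 * real s < real (N - 1) * \<epsilon>\<^sup>2"
        using \<epsilon>0 by (simp only: pos_divide_less_eq zero_less_power)
      moreover have "0 < real (N - 1)" using k_less k_ge by simp
      moreover have "0 < \<epsilon>\<^sup>2" using \<epsilon>0 by simp
      moreover have "2 * \<sigma> / (e * y) < 1 / 128" if "256 * \<sigma> < y * e" "0 < y" "0 < e" for \<sigma> y e :: real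
        using that by (simp add: field_simps)
      ultimately show "2 * real s / (\<epsilon>\<^sup>2 * real (N - 1)) < 1 / 128" by blast
    qed
    finally show ?thesis .
  qed

  have H: "real (card ?H) \<le> 1 / 128 * real (N choose k)"
  proof -
    \<comment> \<open>By \<open>divisor_sum_le\<close> a divisor takes at most the fraction
      \<open>s / (s + 1)\<close> of the total. The constant 256 in \<open>\<epsilon>\<close> makes
      \<open>2 * \<epsilon> * ?S\<^sup>2\<close> equal to
      \<open>\<theta>\<^sup>2 / 128\<close>.\<close>
    define \<theta> where "\<theta> = ?S / real (s + 1)"
    have \<theta>: "0 < \<theta>" unfolding \<theta>_def using Spos by simp
    let ?C = "{C \<in> nsets A (N + 1 - k). \<theta> \<le> sum w C}"
    have w: "sum w A \<le> ?S" "0 \<le> sum w A" "(\<Sum>x\<in>A. (w x)\<^sup>2) \<le> \<epsilon> * ?S * ?S"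
    proof -
      show "sum w A \<le> ?S" by (intro sum_mono) (simp add: w_def)
      show "0 \<le> sum w A" by (intro sum_nonneg) (simp add: w_def)
      have "(w x)\<^sup>2 \<le> \<epsilon> * ?S * real x" if "x \<in> A" for x
      proof (cases "x \<in> L")
        case False
        then have "real x \<le> \<epsilon> * ?S" using that by (simp add: L_def)
        then show ?thesis using False by (simp add: w_def power2_eq_square mult_right_mono)
      qed (use \<epsilon>0 Spos in \<open>simp add: w_def\<close>)
      then have "(\<Sum>x\<in>A. (w x)\<^sup>2) \<le> (\<Sum>x\<in>A. \<epsilon> * ?S * real x)" by (rule sum_mono)
      then show "(\<Sum>x\<in>A. (w x)\<^sup>2) \<le> \<epsilon> * ?S * ?S" by (simp add: sum_distrib_left)
    qed
    have "card ?H \<le> card ?C"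
    proof (rule card_inj_on_le[where f = "\<lambda>B. A - B"])
      show "inj_on (\<lambda>B. A - B) ?H"
        by (rule inj_onI) (auto simp: F1_def nsets_def)
      show "finite ?C" using fin_A by (simp add: finite_imp_finite_nsets)
      show "(\<lambda>B. A - B) ` ?H \<subseteq> ?C"
      proof
        fix C assume "C \<in> (\<lambda>B. A - B) ` ?H"
        then obtain B where B: "B \<in> nsets A k" "\<Sum>B dvd M" "(A - B) \<inter> L = {}" and C: "C = A - B"
          unfolding F1_def by blast
        have B': "B \<subseteq> A" "finite B" "card B = k" using B(1) by (auto simp: nsets_def)
        have "C \<in> nsets A (N + 1 - k)"
          using B' C fin_A card_A by (auto simp: nsets_def card_Diff_subset)
        moreover have "\<theta> \<le> sum w C"
        proof -
          have "sum w C = sum real C" using B(3) C by (intro sum.cong) (auto simp: w_def)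
          also have "\<dots> = ?S - sum real B" unfolding C using fin_A B'(1) by (rule sum_diff)
          finally have wC: "sum w C = ?S - sum real B" .
          have "real (s + 1) * sum real B \<le> real s * ?S"
            using of_nat_mono[OF divisor_sum_le[OF B(1,2)], where 'a = real]
            unfolding MS[symmetric] of_nat_mult of_nat_sum[where f = "\<lambda>x. x"] by simp
          then have "?S \<le> real (s + 1) * (?S - sum real B)" by (simp add: algebra_simps)
          then show ?thesis unfolding wC \<theta>_def by (simp add: field_simps)
        qed
        ultimately show "C \<in> ?C" by simp
      qed
    qed
    then have "real (card ?H) * \<theta>\<^sup>2 \<le> real (card ?C) * \<theta>\<^sup>2" by (intro mult_right_mono) auto
    also have "\<dots> \<le> real ((card A - 1) choose (N + 1 - k - 1))
      * ((\<Sum>x\<in>A. (w x)\<^sup>2) + real (N + 1 - k - 1) / real (card A - 1) * (sum w A)\<^sup>2)"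
      using fin_A card_A k_ge k_less \<theta> by (intro card_nsets_large_sum_le) auto
    also have "\<dots> \<le> real (N choose k) * (\<epsilon> * ?S * ?S + \<epsilon> * ?S\<^sup>2)"
    proof (intro mult_mono add_mono)
      \<comment> \<open>For complements the prefactor is \<open>N choose (N - k)\<close>, hence
        \<open>N choose k\<close> by symmetry.\<close>
      show "real ((card A - 1) choose (N + 1 - k - 1)) \<le> real (N choose k)"
        using card_A k_less binomial_symmetric[of k N] by simp
      show "(\<Sum>x\<in>A. (w x)\<^sup>2) \<le> \<epsilon> * ?S * ?S" by (rule w)
      have "real (N + 1 - k) * real N \<le> \<epsilon> * real (N + 1) * real N"
        using m by (intro mult_right_mono) auto
      moreover have "real (N + 1 - k - 1) * real (N + 1) \<le> real (N + 1 - k) * real N"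
        using k_less by (simp add: of_nat_diff algebra_simps)
      ultimately have "real (N + 1 - k - 1) * real (N + 1) \<le> (\<epsilon> * real N) * real (N + 1)"
        by (simp only: ac_simps)
      then have "real (N + 1 - k - 1) \<le> \<epsilon> * real N"
        by (simp only: mult_le_cancel_right; simp)
      then show "real (N + 1 - k - 1) / real (card A - 1) \<le> \<epsilon>"
        using N card_A by (simp add: field_simps)
      show "(sum w A)\<^sup>2 \<le> ?S\<^sup>2" using w by (intro power_mono)
    qed (use \<epsilon>0 in \<open>auto intro!: add_nonneg_nonneg sum_nonneg mult_nonneg_nonneg\<close>)
    also have "\<dots> = real (N choose k) * (2 * \<epsilon> * ?S\<^sup>2)" by (simp add: power2_eq_square)
    also have "2 * \<epsilon> * ?S\<^sup>2 = 1 / 128 * \<theta>\<^sup>2"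
      unfolding \<epsilon> \<theta>_def by (simp add: power_divide)
    finally have "real (card ?H) * \<theta>\<^sup>2 \<le> (1 / 128 * real (N choose k)) * \<theta>\<^sup>2" by simp
    then show ?thesis using \<theta> by (simp only: mult_le_cancel_right; simp)
  qed
  show False using cover G H card_F1_ge[OF mid] by simp
qed

section \<open>Counterexamples with \<open>k\<close> at most \<open>N / 16\<close>\<close>

definition "NF = {B \<in> nsets A' k. \<not> \<Sum>B dvd M}"

text \<open>The lower bound on the number of divisors, restated: each non-divisor avoiding
  \<open>a\<close> must be compensated by a divisor containing \<open>a\<close>.\<close>

lemma card_NF_le: "card NF \<le> card F1"
proof -
  have "nsets A' k = F0 \<union> NF" "F0 \<inter> NF = {}" unfolding F0_def NF_def by auto
  moreover have "finite NF" unfolding NF_def using fin_A' by (simp add: finite_imp_finite_nsets)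
  ultimately have "N choose k = card F0 + card NF"
    using card_Un_disjoint[of F0 NF] fin_F card_nsets[OF fin_A', of k] card_A' by simp
  then show ?thesis using card_F0_F1 by linarith
qed

definition "b = Max A'"

lemma b_in: "b \<in> A'" and b_ge: "x \<in> A' \<Longrightarrow> x \<le> b"
proof -
  have "A' \<noteq> {}" using card_A' N_pos by auto
  then show "b \<in> A'" "x \<in> A' \<Longrightarrow> x \<le> b" using fin_A' unfolding b_def by auto
qed

lemma b_pos: "0 < b" and b_le_a: "b \<le> a"
  using b_in pos a_ge unfolding A'_def by auto

lemma Suc_k: "Suc (k - 1) = k"
  using k_ge by simp

text \<open>If \<open>M / b\<close> is small, then most \<open>k\<close>-subsets of \<open>A'\<close> containing \<open>b\<close> are not divisors.\<close>

lemma small_range_heavy: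
  assumes k: "16 * k \<le> N" and heavy: "16 * M \<le> N * b"
  shows False
proof -
  let ?P = "real ((N - 1) choose (k - 1))"
  have N: "0 < real N" "0 < real (N - 1)" "2 \<le> N" using k k_ge by simp_all
  have heavy': "16 * real M \<le> real N * real b"
    using of_nat_mono[OF heavy, where 'a = real] by simp
  have P: "0 < ?P" using k_less by simp
  have b: "0 < real b" using b_pos by simp
  have "real (card F1) \<le> 2 * real M / (real b * real N) * real (N choose (k - 1))"
    using b_le_a b by (intro card_F1_le) auto
  also have "\<dots> \<le> 1 / 8 * real (N choose (k - 1))"
    using heavy' b N by (intro mult_right_mono) (auto simp: field_simps)
  also have "real (N choose (k - 1)) \<le> 2 * ?P"
  proof -
    \<comment> \<open>The ratio of the two binomials is \<open>N / (N - k + 1)\<close>, at most 2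
      because \<open>k\<close> is at most \<open>N / 16\<close>.\<close>
    have "N * (N choose (k - 1)) \<le> 2 * (N - (k - 1)) * (N choose (k - 1))"
      using k by (intro mult_le_mono1) simp
    also have "\<dots> = 2 * (N * ((N - 1) choose (k - 1)))"
      by (simp only: mult.assoc binomial_absorb_comp)
    finally have "N * (N choose (k - 1)) \<le> N * (2 * ((N - 1) choose (k - 1)))"
      by (simp only: mult.left_commute)
    then have "N choose (k - 1) \<le> 2 * ((N - 1) choose (k - 1))" using N_pos by simp
    then show ?thesis by linarith
  qed
  finally have F1: "real (card F1) \<le> 1 / 4 * ?P" by simp

  let ?Db = "{B \<in> nsets A' k. b \<in> B \<and> \<Sum>B dvd M}"
  let ?H = "{Y \<in> nsets (A' - {b}) (k - 1). b + \<Sum>Y dvd M \<and> real b \<le> real (b + \<Sum>Y)}"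
  have "card ?Db \<le> card {Y \<in> nsets (A' - {b}) (k - 1). b + \<Sum>Y dvd M}"
    using card_nsets_containing_sum_le[OF fin_A' b_in, of "k - 1" "\<lambda>t. t dvd M"] unfolding Suc_k .
  also have "{Y \<in> nsets (A' - {b}) (k - 1). b + \<Sum>Y dvd M} = ?H"
  proof -
    have "real b \<le> real (b + t)" for t by simp
    then show ?thesis by blast
  qed
  finally have "real (card ?Db) \<le> real (card ?H)" by (simp only: of_nat_le_iff)
  also have "\<dots> \<le> 2 * real M / (real b * real (card (A' - {b}))) * real (card (A' - {b}) choose (k - 1))"
    using fin_A' b_in card_A' k_ge k_less b M_pos by (intro card_nsets_sum_dvd_le) auto
  also have "card (A' - {b}) = N - 1" using fin_A' b_in card_A' by simp
  also have "2 * real M / (real b * real (N - 1)) * ?P \<le> 1 / 4 * ?P"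
  proof (rule mult_right_mono)
    have "real N \<le> 2 * real (N - 1)" using N(3) by simp
    then have "real N * real b \<le> 2 * real (N - 1) * real b" by (rule mult_right_mono) simp
    moreover have "2 * m / (\<beta> * y) \<le> 1 / 4" if "16 * m \<le> x * \<beta>" "x * \<beta> \<le> 2 * y * \<beta>" "0 < \<beta>" "0 < y" for m x \<beta> y :: real
    proof -
      have "8 * m \<le> \<beta> * y" using that(1,2) by (simp only: ac_simps; linarith)
      then show ?thesis using that(3,4) by (simp add: field_simps)
    qed
    ultimately show "2 * real M / (real b * real (N - 1)) \<le> 1 / 4"
      using heavy' b N(2) by blast
  qed simp
  finally have Db: "real (card ?Db) \<le> 1 / 4 * ?P" .

  \<comment> \<open>All \<open>?P\<close> sets containing \<open>b\<close> lie in \<open>NF\<close>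
    or \<open>?Db\<close>, but \<open>NF\<close> is no larger than \<open>F1\<close>, so both
    together have at most \<open>?P / 2\<close> members.\<close>
  have "{B \<in> nsets A' k. b \<in> B} \<subseteq> NF \<union> ?Db" unfolding NF_def by auto
  then have "real (card {B \<in> nsets A' k. b \<in> B}) \<le> real (card NF) + real (card ?Db)"
    using fin_A' by (intro card_le_by_cover) (auto simp: NF_def finite_imp_finite_nsets)
  also have "card {B \<in> nsets A' k. b \<in> B} = (N - 1) choose (k - 1)"
    using card_nsets_containing[OF fin_A' b_in, of "k - 1"] unfolding Suc_k card_A' .
  finally show False using Db F1 P of_nat_mono[OF card_NF_le, where 'a = real] by linarith
qed

text \<open>If \<open>M / b\<close> is large, then the total of \<open>A'\<close> is of order \<open>N b\<close>, so a positive proportion of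
  its elements have size of order \<open>b\<close>, and four of them lie within distance \<open>O(b / N)\<close>.\<close>

lemma cluster:
  assumes q: "q = 16 * s * (s + 1)" and light: "N * b < 16 * M"
  obtains Z where "Z \<subseteq> A'" "card Z = 4" "\<And>z. z \<in> Z \<Longrightarrow> b \<le> 2 * q * z"
    "\<And>u v. u \<in> Z \<Longrightarrow> v \<in> Z \<Longrightarrow> (u - v) * N \<le> 24 * q * b"
proof -
  have q0: "0 < q" using q s_pos by simp
  have N: "36 * q \<le> N"
  proof -
    have "36 * q \<le> 2 ^ 40 * (s + 1) ^ 2" unfolding q power2_eq_square by (simp add: algebra_simps)
    also have "\<dots> \<le> 2 ^ 40 * (s + 1) ^ 8" by (intro mult_le_mono2 power_increasing) auto
    also note N_large
    finally show ?thesis .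
  qed
  \<comment> \<open>The elements of size comparable to \<open>b\<close>. The others contribute at
    most \<open>N * b\<close> to \<open>2 * q * \<Sum>A'\<close>, which exceeds
    \<open>2 * N * b\<close>, so \<open>G\<close> has more than \<open>N / (2 * q)\<close>
    elements.\<close>
  define G where "G = {x \<in> A'. b \<le> 2 * q * x}"
  have finG: "finite G" using fin_A' by (simp add: G_def)
  have "16 * M \<le> q * \<Sum>A'"
    using mult_le_mono2[OF sum_A_le, of "16 * s"] unfolding M_def q by (simp only: ac_simps)
  then have "2 * (N * b) < 2 * q * \<Sum>A'" using light by linarith
  also have "2 * q * \<Sum>A' = (\<Sum>x\<in>A'. 2 * q * x)" by (rule sum_distrib_left)
  also have "\<dots> = (\<Sum>x\<in>A' - G. 2 * q * x) + (\<Sum>x\<in>G. 2 * q * x)"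
    using fin_A' by (intro sum.subset_diff) (auto simp: G_def)
  also have "(\<Sum>x\<in>A' - G. 2 * q * x) \<le> of_nat (card (A' - G)) * b"
    by (rule sum_bounded_above) (auto simp: G_def)
  also have "of_nat (card (A' - G)) * b \<le> N * b"
    using card_mono[OF fin_A', of "A' - G"] card_A' by simp
  also have "(\<Sum>x\<in>G. 2 * q * x) \<le> of_nat (card G) * (2 * q * b)"
    by (rule sum_bounded_above) (auto simp: G_def b_ge)
  finally have "N * b < (2 * q * card G) * b" by (simp add: algebra_simps)
  then have cG: "N < 2 * q * card G" by simp
  \<comment> \<open>Cells of width \<open>b / L\<close>, indexed by \<open>x * L div b\<close>,
    which takes at most \<open>L + 1\<close> values. The factor 12 gives
    \<open>3 * (L + 1) \<le> 6 * L \<le> N / (2 * q) < card G\<close>, so some cell holds four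
    elements.\<close>
  define L where "L = N div (12 * q)"
  have LN: "12 * q * L \<le> N" "N < 12 * q * (L + 1)"
    unfolding L_def using q0 by (simp_all add: div_times_less_eq_dividend dividend_less_times_div mult.commute)
  have L3: "3 \<le> L" unfolding L_def using N q0 by (simp add: less_eq_div_iff_mult_less_eq mult.commute)
  have "q * (3 * (L + 1)) \<le> q * (6 * L)" using L3 by (intro mult_le_mono2) simp
  then have "2 * q * (3 * (L + 1)) < 2 * q * card G" using LN(1) cG by linarith
  then have "3 * (L + 1) < card G" by simp
  moreover have "x * L div b \<le> L" if "x \<in> G" for x
  proof -
    have "x \<le> b" using that b_ge by (auto simp: G_def)
    then have "x * L div b \<le> b * L div b" by (intro div_le_mono mult_le_mono1)
    then show ?thesis using b_pos by simp
  qed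
  ultimately obtain y where "3 < card {x \<in> G. x * L div b = y}"
    using pigeonhole_bounded[OF finG, of "\<lambda>x. x * L div b" L 3] by blast
  then obtain Z where Z: "Z \<subseteq> {x \<in> G. x * L div b = y}" "card Z = 4"
    using obtain_subset_with_card_n[of 4 "{x \<in> G. x * L div b = y}"] by auto
  \<comment> \<open>Subtraction is truncated, so only \<open>v < u\<close> has content: elements of
    one cell differ by at most \<open>b / L\<close>, and \<open>N \<le> 24 * q * L\<close>.\<close>
  have "(u - v) * N \<le> 24 * q * b" if "u \<in> Z" "v \<in> Z" for u v
  proof -
    have uv: "u * L div b = v * L div b" using that Z by blast
    have "u * L < b * (u * L div b) + b"
      using mult_div_mod_eq[of b "u * L"] mod_less_divisor[OF b_pos, of "u * L"] by linarith
    moreover have "b * (v * L div b) \<le> v * L" by simp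
    ultimately have "u * L \<le> v * L + b" unfolding uv by linarith
    then have "(u - v) * L \<le> b" by (simp add: diff_mult_distrib)
    have "12 * q * (L + 1) \<le> 12 * q * (2 * L)" using L3 by (intro mult_le_mono2) simp
    moreover have "12 * q * (2 * L) = 24 * q * L" by simp
    ultimately have "N \<le> 24 * q * L" using LN(2) by linarith
    then have "(u - v) * N \<le> (u - v) * (24 * q * L)" by (rule mult_le_mono2)
    also have "\<dots> = 24 * q * ((u - v) * L)" by (simp only: ac_simps)
    also have "\<dots> \<le> 24 * q * b" using \<open>(u - v) * L \<le> b\<close> by (rule mult_le_mono2)
    finally show ?thesis .
  qed
  then show ?thesis using that Z unfolding G_def by blast
qed

text \<open>Adding two different elements of the cluster to the same \<open>(k - 1)\<close>-set rarely gives two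
  divisors, so at least three quarters of the sets obtained in this way are not divisors.\<close>

lemma small_range_light:
  assumes k: "16 * k \<le> N" and light: "N * b < 16 * M"
  shows False
proof -
  define q where "q = 16 * s * (s + 1)"
  obtain Z where Z: "Z \<subseteq> A'" "card Z = 4" "\<And>z. z \<in> Z \<Longrightarrow> b \<le> 2 * q * z"
    and close: "\<And>u v. u \<in> Z \<Longrightarrow> v \<in> Z \<Longrightarrow> (u - v) * N \<le> 24 * q * b"
    using cluster[OF q_def light] by blast
  have finZ: "finite Z" using Z(1) fin_A' finite_subset by blast
  have Zpos: "0 < z" if "z \<in> Z" for z using that Z(1) pos by (auto simp: A'_def)
  \<comment> \<open>The bound on cofactor differences: \<open>16 * M \<le> q * N * b\<close>,
    \<open>(u - v) * N \<le> 24 * q * b\<close>, \<open>b \<le> 2 * q * u\<close> and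
    \<open>b \<le> 2 * q * v\<close> combine to
    \<open>M * (u - v) \<le> 6 * q ^ 4 * u * v\<close>.\<close>
  define E where "E = 6 * q ^ 4"
  have NE: "4 + 128 * E \<le> N"
  proof -
    have "q \<le> 16 * (s + 1) ^ 2" unfolding q_def power2_eq_square by simp
    then have "q ^ 4 \<le> (16 * (s + 1) ^ 2) ^ 4" by (rule power_mono) simp
    also have "\<dots> = 2 ^ 16 * (s + 1) ^ 8" by (simp only: power_mult_distrib power_mult[symmetric]) simp
    finally have "128 * E \<le> 2 ^ 26 * (s + 1) ^ 8" unfolding E_def by simp
    moreover have "1 \<le> (s + 1) ^ 8" by (rule one_le_power) simp
    moreover have "4 + e \<le> m" if "e \<le> 2 ^ 26 * x" "1 \<le> x" "2 ^ 40 * x \<le> m" for e x m :: nat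
      using that by simp
    ultimately show ?thesis using N_large by blast
  qed
  \<comment> \<open>The sums that two different cluster elements both complete to a divisor of
    \<open>M\<close>.\<close>
  define V where "V = (\<Union>(u, v)\<in>{(u, v) \<in> Z \<times> Z. v < u}. {t. u + t dvd M \<and> v + t dvd M})"
  have pair: "finite {t. u + t dvd M \<and> v + t dvd M} \<and> card {t. u + t dvd M \<and> v + t dvd M} \<le> E"
    if "u \<in> Z" "v \<in> Z" "v < u" for u v
  proof -
    have "\<Sum>A' \<le> of_nat (card A') * b" by (rule sum_bounded_above) (rule b_ge)
    have "16 * s * \<Sum>A \<le> 16 * s * ((s + 1) * (N * b))"
    proof (rule mult_le_mono2)
      have "\<Sum>A' \<le> N * b" using \<open>\<Sum>A' \<le> _\<close> card_A' by simp
      then have "(s + 1) * \<Sum>A' \<le> (s + 1) * (N * b)" by (rule mult_le_mono2)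
      then show "\<Sum>A \<le> (s + 1) * (N * b)" by (rule order_trans[OF sum_A_le])
    qed
    then have "16 * M \<le> q * (N * b)" unfolding M_def q_def by (simp only: ac_simps)
    then have "16 * M * (u - v) \<le> q * (N * b) * (u - v)" by (rule mult_le_mono1)
    also have "\<dots> = q * b * ((u - v) * N)" by (simp only: ac_simps)
    also have "\<dots> \<le> q * b * (24 * q * b)" using close[OF that(1,2)] by (rule mult_le_mono2)
    also have "\<dots> = 24 * q * q * (b * b)" by (simp only: ac_simps)
    also have "\<dots> \<le> 24 * q * q * ((2 * q * u) * (2 * q * v))"
      using Z(3)[OF that(1)] Z(3)[OF that(2)] by (intro mult_le_mono2 mult_le_mono)
    also have "\<dots> = 16 * (E * (u * v))" unfolding E_def by (simp add: power4_eq_xxxx algebra_simps)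
    finally have "M * (u - v) \<le> E * (u * v)" by (simp add: mult.assoc)
    then show ?thesis using common_shift_divisors[OF M_pos Zpos[OF that(2)] that(3)] by (intro conjI)
  qed
  have finP: "finite {(u, v) \<in> Z \<times> Z. v < u}" 
    by (rule finite_subset[of _ "Z \<times> Z"]) (use finZ in auto)
  have finV: "finite V" unfolding V_def
  proof (rule finite_UN_I[OF finP])
    fix p assume "p \<in> {(u, v) \<in> Z \<times> Z. v < u}"
    then obtain u v where "p = (u, v)" "u \<in> Z" "v \<in> Z" "v < u" by blast
    then show "finite (case p of (u, v) \<Rightarrow> {t. u + t dvd M \<and> v + t dvd M})"
      using pair by (simp only: prod.case)
  qed
  have cardV: "card V \<le> 16 * E"
  proof -
    have "card V \<le> (\<Sum>p\<in>{(u, v) \<in> Z \<times> Z. v < u}. card (case p of (u, v) \<Rightarrow> {t. u + t dvd M \<and> v + t dvd M}))"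
      unfolding V_def by (rule card_UN_le[OF finP])
    also have "\<dots> \<le> of_nat (card {(u, v) \<in> Z \<times> Z. v < u}) * E"
    proof (rule sum_bounded_above)
      fix p assume "p \<in> {(u, v) \<in> Z \<times> Z. v < u}"
      then obtain u v where "p = (u, v)" "u \<in> Z" "v \<in> Z" "v < u" by blast
      then show "card (case p of (u, v) \<Rightarrow> {t. u + t dvd M \<and> v + t dvd M}) \<le> E"
        using pair by (simp only: prod.case)
    qed
    also have "\<dots> \<le> card (Z \<times> Z) * E"
      using finZ unfolding of_nat_id by (intro mult_le_mono1 card_mono) auto
    also have "card (Z \<times> Z) = 16" using Z(2) by (simp add: card_cartesian_product)
    finally show ?thesis by simp
  qed
  \<comment> \<open>For \<open>Y\<close> disjoint from \<open>Z\<close>, removing \<open>Z\<close>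
    from \<open>insert z Y\<close> recovers \<open>Y\<close>; hence the pairs \<open>(Y, z)\<close>
    counted below inject into \<open>NF\<close>.\<close>
  let ?X = "A' - Z"
  have cX: "card ?X = N - 4" using Z finZ card_A' by (simp add: card_Diff_subset)
  have finX: "finite ?X" using fin_A' by simp
  let ?D = "(N - 4) choose (k - 1)"
  \<comment> \<open>At most \<open>16 * E\<close> forbidden sums among subsets of
    \<open>N - 4\<close> elements give a proportion \<open>32 * E / (N - 4)\<close>, which
    \<open>NE\<close> bounds by \<open>1 / 4\<close>.\<close>
  let ?Bad = "{Y \<in> nsets ?X (k - 1). \<Sum>Y \<in> V}"
  have finY: "finite (nsets ?X (k - 1))" using finX by (rule finite_imp_finite_nsets)
  have "card ?Bad * card ?X \<le> 2 * card V * (card ?X choose (k - 1))"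
    using k k_ge cX finV finX by (intro card_nsets_sum_in_le) auto
  from mult_le_mono2[OF this, of 4] have "4 * card ?Bad * (N - 4) \<le> 4 * (2 * card V) * ?D"
    by (simp only: cX mult.assoc)
  also have "\<dots> \<le> (N - 4) * ?D" using cardV NE by (intro mult_le_mono1) simp
  also have "\<dots> = ?D * (N - 4)" by (rule mult.commute)
  finally have bad: "4 * card ?Bad \<le> ?D" using k k_ge by (simp only: mult_le_cancel2; simp)

  let ?Q = "Sigma (nsets ?X (k - 1)) (\<lambda>Y. {z \<in> Z. \<not> z + \<Sum>Y dvd M})"
  have "3 \<le> card {z \<in> Z. \<not> z + \<Sum>Y dvd M}" if Y: "Y \<in> nsets ?X (k - 1) - ?Bad" for Y
  proof -
    have "x = y" if "x \<in> Z" "y \<in> Z" "x + \<Sum>Y dvd M" "y + \<Sum>Y dvd M" for x y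
    proof (rule ccontr)
      assume "x \<noteq> y"
      then have "x < y \<or> y < x" by linarith
      then have "\<Sum>Y \<in> V" unfolding V_def using that by blast
      then show False using Y by blast
    qed
    then have "card {z \<in> Z. z + \<Sum>Y dvd M} \<le> 1"
      using finZ by (subst card_le_Suc0_iff_eq[unfolded One_nat_def[symmetric]]) auto
    moreover have "card Z = card ({z \<in> Z. z + \<Sum>Y dvd M} \<union> {z \<in> Z. \<not> z + \<Sum>Y dvd M})"
      by (rule arg_cong[where f = card]) auto
    then have "card Z \<le> card {z \<in> Z. z + \<Sum>Y dvd M} + card {z \<in> Z. \<not> z + \<Sum>Y dvd M}"
      by (simp only: card_Un_le)
    ultimately show ?thesis using Z(2) by linarith
  qed
  then have "of_nat (card (nsets ?X (k - 1) - ?Bad)) * 3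
      \<le> (\<Sum>Y\<in>nsets ?X (k - 1) - ?Bad. card {z \<in> Z. \<not> z + \<Sum>Y dvd M})"
    by (rule sum_bounded_below)
  also have "\<dots> \<le> (\<Sum>Y\<in>nsets ?X (k - 1). card {z \<in> Z. \<not> z + \<Sum>Y dvd M})"
    using finY by (intro sum_mono2) auto
  also have "\<dots> = card ?Q"
    using finY finZ by (subst card_SigmaI) auto
  also have "\<dots> \<le> card NF"
  proof (rule card_inj_on_le[where f = "\<lambda>(Y, z). insert z Y"])
    show "inj_on (\<lambda>(Y, z). insert z Y) ?Q"
    proof (rule inj_onI, clarify)
      fix Y z Y' z'
      assume Y: "Y \<in> nsets ?X (k - 1)" "Y' \<in> nsets ?X (k - 1)" and z: "z \<in> Z" "z' \<in> Z"
        and e: "insert z Y = insert z' Y'"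
      have d: "Y \<inter> Z = {}" "Y' \<inter> Z = {}" using Y by (auto simp: nsets_def)
      have "Y = insert z Y - Z" "Y' = insert z' Y' - Z" using d z by auto
      then have "Y = Y'" using e by simp
      moreover have "z = z'" using e d z \<open>Y = Y'\<close> by blast
      ultimately show "Y = Y' \<and> z = z'" by simp
    qed
    show "(\<lambda>(Y, z). insert z Y) ` ?Q \<subseteq> NF"
    proof clarify
      fix Y z assume Y: "Y \<in> nsets ?X (k - 1)" and z: "z \<in> Z" and nd: "\<not> z + \<Sum>Y dvd M"
      have Y': "Y \<subseteq> A'" "finite Y" "card Y = k - 1" "z \<notin> Y" using Y z by (auto simp: nsets_def)
      then have "\<Sum>(insert z Y) = z + \<Sum>Y" by simp
      moreover have "insert z Y \<in> nsets A' k"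
        using Y' z Z(1) Suc_k by (auto simp: nsets_def)
      ultimately show "insert z Y \<in> NF" using nd unfolding NF_def by simp
    qed
    show "finite NF" unfolding NF_def using fin_A' by (simp add: finite_imp_finite_nsets)
  qed
  finally have "3 * card (nsets ?X (k - 1) - ?Bad) \<le> card NF" by simp
  moreover have "card (nsets ?X (k - 1) - ?Bad) = ?D - card ?Bad"
    using finY finX card_Diff_subset[of ?Bad "nsets ?X (k - 1)"] cX by (simp add: card_nsets)
  \<comment> \<open>Three non-divisors from each of three quarters of the sets yield
    \<open>9 / 4 * ?D\<close>, beating the bound \<open>2 * ?D\<close> for \<open>F1\<close>. A
    cluster of three would yield less than \<open>2 * ?D\<close>.\<close>
  ultimately have "9 * ?D \<le> 4 * card NF" using bad by linarith
  moreover have "card F1 \<le> N choose (k - 1)"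
  proof -
    have "card F1 \<le> card {B \<in> nsets A k. a \<in> B}"
      using fin_A unfolding F1_def by (intro card_mono) (auto simp: finite_imp_finite_nsets)
    also have "\<dots> = N choose (k - 1)"
      using card_nsets_containing[OF fin_A a_in, of "k - 1"] unfolding Suc_k card_A by simp
    finally show ?thesis .
  qed
  moreover have "N choose (k - 1) \<le> 2 * ?D"
    using binomial_le_twice[of "k - 1" N] k unfolding Suc_k by simp
  moreover have "0 < ?D" using k k_ge by simp
  ultimately show False using card_NF_le by linarith
qed

lemma contradiction: False
proof (cases "16 * k \<le> N")
  case True
  then show ?thesis using small_range_heavy small_range_light by (meson not_le)
next
  case False
  then show ?thesis using middle_range[OF _ refl] large_range[OF refl] by (meson nat_le_linear not_le)
qed

end

section \<open>Reduction to large \<open>n\<close> and a divisor containing the maximum\<close>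

theorem theorem4:
  fixes s :: nat
  assumes "s \<ge> 1"
  shows "finite {(k :: nat, n :: nat). 1 < k \<and> k < n - 1 \<and>
           \<not> (\<forall>A :: nat set. finite A \<and> 0 \<notin> A \<and> card A = n \<and> num_s_divisors s k A \<ge> (n - 1) choose k
                \<longrightarrow> anti_pencil k s A)}"
proof -
  let ?N = "2 ^ 40 * (s + 1) ^ 8 :: nat"
  have bound: "k \<le> ?N \<and> n \<le> ?N"
    if kn: "1 < k" "k < n - 1" and A: "finite A" "0 \<notin> A" "card A = n"
      and many: "(n - 1) choose k \<le> num_s_divisors s k A" and nap: "\<not> anti_pencil k s A" for k n A
  proof -
    \<comment> \<open>\<open>1 < k\<close> and \<open>k < n - 1\<close> exclude
      \<open>n = 0\<close>, so the truncated \<open>n - 1\<close> is a genuine predecessor.\<close>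
    have cA: "card A = Suc (n - 1)" using kn A by simp
    then have "A \<noteq> {}" by auto
    have "n - 1 < ?N"
    proof (rule ccontr)
      assume large: "\<not> ?thesis"
      \<comment> \<open>Otherwise the divisors form a subfamily of
        \<open>nsets (A - {Max A}) k\<close> of at least its full cardinality, hence all of
        it.\<close>
      have "\<exists>B \<in> k_s_divisors k s A. Max A \<in> B"
      proof (rule ccontr)
        assume "\<not> ?thesis"
        then have sub: "k_s_divisors k s A \<subseteq> nsets (A - {Max A}) k"
          unfolding k_s_divisors_def nsets_def by auto
        have "card (nsets (A - {Max A}) k) = (n - 1) choose k"
          using A \<open>A \<noteq> {}\<close> by (simp add: card_nsets)
        then have "k_s_divisors k s A = nsets (A - {Max A}) k"
          using sub many A(1) unfolding num_s_divisors_def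
          by (intro card_seteq) (auto simp: finite_imp_finite_nsets)
        then show False using nap unfolding anti_pencil_def by blast
      qed
      then have "many_divisors s k (n - 1) A"
        using kn A many assms large cA by unfold_locales auto
      then show False by (rule many_divisors.contradiction)
    qed
    then show ?thesis using kn by simp
  qed
  show ?thesis
    proof (rule finite_subset)
    show "finite ({..?N} \<times> {..?N})" by simp
    show "{(k, n). 1 < k \<and> k < n - 1 \<and>
           \<not> (\<forall>A. finite A \<and> 0 \<notin> A \<and> card A = n \<and> (n - 1) choose k \<le> num_s_divisors s k A
                \<longrightarrow> anti_pencil k s A)} \<subseteq> {..?N} \<times> {..?N}"
    proof (rule subrelI)
      fix k n
      assume "(k, n) \<in> {(k, n). 1 < k \<and> k < n - 1 \<and>
           \<not> (\<forall>A. finite A \<and> 0 \<notin> A \<and> card A = n \<and> (n - 1) choose k \<le> num_s_divisors s k A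
                \<longrightarrow> anti_pencil k s A)}"
      then obtain A where "1 < k" "k < n - 1" "finite A" "0 \<notin> A" "card A = n"
        "(n - 1) choose k \<le> num_s_divisors s k A" "\<not> anti_pencil k s A"
        unfolding mem_Collect_eq prod.case by blast
      then have "k \<le> ?N \<and> n \<le> ?N" by (rule bound)
      then show "(k, n) \<in> {..?N} \<times> {..?N}" by (simp only: mem_Sigma_iff atMost_iff)
    qed
  qed
qed
end
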